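(* Assume that $\alpha d>r-1$, where $\alpha=\frac{p-1}{4}$ with $p$ an odd natural number. Then there exists a smooth solution $(U_R(\zeta),S(\zeta))$, with decay at infinity, to the system of ordinary differential equations $$ \begin{aligned} 0 &= -(r-1)U_R-\zeta\,\partial_\zeta U_R-U_R\,\partial_\zeta U_R+\alpha S\,\partial_\zeta S,\\ 0 &= -(r-1)S-\zeta\,\partial_\zeta S-U_R\,\partial_\zeta S-\alpha S\,\partial_\zeta U_R-\alpha(d-1)\frac{S\,U_R}{\zeta}. \end{aligned} $$ Moreover, $U_R$ admits a $C^\infty$ odd extension and $S$ admits a $C^\infty$ even extension with respect to $\zeta$, so that the radially symmetric vector field $y\mapsto U_R(|y|)\frac{y}{|y|}$ and the radially symmetric scalar field $y\mapsto S(|y|)$ generated by them on $\mathbb R^d$ are smooth. Under the scaling symmetry of the system, one can take $S(0)=1$ and $U_R'(0)=-\frac{r-1}{\alpha d}$.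
   Context: Here $d$ is the space dimension, $r$ is the (real) self-similar scaling parameter, and $U_R$, $S$ are real-valued functions of the radial variable $\zeta=|y|$, $y\in\mathbb R^d$. The system is the stationary radial self-similar form of the hydrodynamic (Madelung) formulation of the focusing nonlinear Schrödinger equation $i\partial_t v+\Delta v+v|v|^{p-1}=0$ on $\mathbb R^d$, with the quantum pressure term neglected; the self-similar variable is $y=x/(T-t)^{1/r}$, with $T$ the blow-up time. The scaling symmetry is: if $(U_R(\zeta),S(\zeta))$ solves the system and $\lambda>0$, then so does $(\lambda^{-1}U_R(\lambda\zeta),\lambda^{-1}S(\lambda\zeta))$. The values $S(0)$ and $U_R'(0)$ refer to the smooth extensions to $\zeta=0$.
   Formalization: The formal theorem assumes in addition r > 1; for r ≤ 1 no smooth solution with decay at infinity has S(0) = 1 (for r = 1 the normalised solution is the constant (0,1)), so the claim fails there. *)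

theory Defs
  imports "HOL-Analysis.Analysis"
begin

text \<open>The class \<open>C\<^sup>k\<close> on an open set \<open>X\<close> of a finite-dimensional space, via directional
  derivatives: the domain being finite-dimensional, continuity of all of them up to order \<open>k\<close>
  is the same as continuity of the iterated total derivatives.  The derivatives are taken in
  the full space, so the notion is meant for open \<open>X\<close> only.\<close>

primrec Ck_on :: "nat \<Rightarrow> 'a::euclidean_space set \<Rightarrow> ('a \<Rightarrow> 'b::real_normed_vector) \<Rightarrow> bool" where
  "Ck_on 0 X f \<longleftrightarrow> continuous_on X f"
| "Ck_on (Suc k) X f \<longleftrightarrow>
     (\<forall>x\<in>X. f differentiable (at x)) \<and>
     (\<forall>v. Ck_on k X (\<lambda>x. frechet_derivative f (at x) v))"

definition smooth_on :: "'a::euclidean_space set \<Rightarrow> ('a \<Rightarrow> 'b::real_normed_vector) \<Rightarrow> bool" where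
  "smooth_on X f \<longleftrightarrow> (\<forall>k. Ck_on k X f)"

text \<open>\<open>deriv\<close> is total; smoothness on \<open>\<zeta> > 0\<close> is part of the definition, so both
  derivatives in the equations exist.  Values at \<open>\<zeta> \<le> 0\<close> are irrelevant.\<close>

definition smooth_profile_solution ::
  "real \<Rightarrow> real \<Rightarrow> nat \<Rightarrow> (real \<Rightarrow> real) \<Rightarrow> (real \<Rightarrow> real) \<Rightarrow> bool" where
  "smooth_profile_solution \<alpha> r d U S \<longleftrightarrow>
     smooth_on {0<..} U \<and> smooth_on {0<..} S \<and>
     (\<forall>\<zeta>>0.
        0 = - (r - 1) * U \<zeta> - \<zeta> * deriv U \<zeta> - U \<zeta> * deriv U \<zeta> + \<alpha> * S \<zeta> * deriv S \<zeta> \<and>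
        0 = - (r - 1) * S \<zeta> - \<zeta> * deriv S \<zeta> - U \<zeta> * deriv S \<zeta> - \<alpha> * S \<zeta> * deriv U \<zeta>
            - \<alpha> * (real d - 1) * (S \<zeta> * U \<zeta> / \<zeta>))"

definition smooth_odd_extension :: "(real \<Rightarrow> real) \<Rightarrow> (real \<Rightarrow> real) \<Rightarrow> bool" where
  "smooth_odd_extension f g \<longleftrightarrow>
     smooth_on UNIV g \<and> (\<forall>\<zeta>. g (- \<zeta>) = - g \<zeta>) \<and> (\<forall>\<zeta>>0. g \<zeta> = f \<zeta>)"

definition smooth_even_extension :: "(real \<Rightarrow> real) \<Rightarrow> (real \<Rightarrow> real) \<Rightarrow> bool" where
  "smooth_even_extension f g \<longleftrightarrow>
     smooth_on UNIV g \<and> (\<forall>\<zeta>. g (- \<zeta>) = g \<zeta>) \<and> (\<forall>\<zeta>>0. g \<zeta> = f \<zeta>)"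

text \<open>At \<open>y = 0\<close> the vector field takes the value \<open>0\<close> (division by zero), which is the value
  forced by continuity when \<open>U\<close> is continuous and odd.\<close>

definition radial_vector_field :: "(real \<Rightarrow> real) \<Rightarrow> 'a::real_normed_vector \<Rightarrow> 'a" where
  "radial_vector_field U y = U (norm y) *\<^sub>R (y /\<^sub>R norm y)"

definition radial_scalar_field :: "(real \<Rightarrow> real) \<Rightarrow> 'a::real_normed_vector \<Rightarrow> real" where
  "radial_scalar_field S y = S (norm y)"

end

theory Submission
  imports Defs
begin

text \<open>Since the system is focusing, the matrix multiplying \<open>(U', S')\<close> has determinant
  \<open>(\<zeta> + U)\<^sup>2 + \<alpha>\<^sup>2 S\<^sup>2\<close>, so there are no sonic points and the only singularity is the regular one
  at \<open>\<zeta> = 0\<close>.  With \<open>t = \<zeta>\<^sup>2\<close>, \<open>U = \<zeta> u(t)\<close>, \<open>S = exp (l(t))\<close> the problem becomes a Volterra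
  equation on the whole line; after truncating the nonlinearity it is globally Lipschitz and has
  a global solution by Banach's theorem.  The strip \<open>u0 \<le> u \<le> 0\<close>, \<open>u0 = - (r - 1) / (\<alpha> d) > - 1\<close>,
  is invariant for \<open>t \<ge> 0\<close>; there \<open>S\<close> decreases and the determinant stays away from \<open>0\<close>, so the
  truncation is inactive on some \<open>{- \<delta><..}\<close>.  Smoothness in \<open>t\<close> across \<open>0\<close> follows by bootstrapping
  and gives the smooth odd and even extensions and the smooth radial fields.  Decay follows from
  \<open>\<zeta> S' \<le> - c S\<close> and \<open>\<zeta> V' \<le> - c V + C / \<zeta>\<close> for \<open>V = - U\<close>.\<close>

section \<open>Functions of class \<open>C\<^sup>k\<close>\<close>

lemma Ck_on_has_derivativeD:
  "Ck_on (Suc k) X f \<Longrightarrow> x \<in> X \<Longrightarrow> (f has_derivative frechet_derivative f (at x)) (at x)"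
  by (simp add: frechet_derivative_works[symmetric])

lemma Ck_on_frechet: "Ck_on (Suc k) X f \<Longrightarrow> Ck_on k X (\<lambda>x. frechet_derivative f (at x) v)"
  by simp

text \<open>Congruence at level \<open>k\<close> is a hypothesis because the rule already serves
  inside the induction that proves congruence, where the induction hypothesis supplies it.
  \<open>Ck_on_has_derivative\<close> discharges it afterwards.\<close>

lemma Ck_on_SucI:
  fixes f :: "'a::euclidean_space \<Rightarrow> 'b::real_normed_vector"
  assumes "open X" and f': "\<And>x. x \<in> X \<Longrightarrow> (f has_derivative f' x) (at x)"
    and cong: "\<And>g h :: 'a \<Rightarrow> 'b. (\<And>x. x \<in> X \<Longrightarrow> g x = h x) \<Longrightarrow> Ck_on k X g \<Longrightarrow> Ck_on k X h"
    and Ck: "\<And>v. Ck_on k X (\<lambda>x. f' x v)"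
  shows "Ck_on (Suc k) X f"
proof -
  have "f' x v = frechet_derivative f (at x) v" if "x \<in> X" for x v
    using f'[OF that] by (simp add: frechet_derivative_at[symmetric])
  then have "Ck_on k X (\<lambda>x. frechet_derivative f (at x) v)" for v
    by (rule cong[OF _ Ck])
  then show ?thesis
    using f' by (auto simp: differentiable_def)
qed

lemma Ck_on_cong:
  assumes "open X" "\<And>x. x \<in> X \<Longrightarrow> f x = g x" "Ck_on k X f"
  shows "Ck_on k X g"
  using assms(2,3)
proof (induction k arbitrary: f g)
  case 0
  then show ?case by (simp cong: continuous_on_cong)
next
  case (Suc k)
  have D: "(g has_derivative frechet_derivative f (at x)) (at x)" if "x \<in> X" for x
    using has_derivative_transform_within_open[OF Ck_on_has_derivativeD[OF Suc.prems(2) that] \<open>open X\<close> that]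
      Suc.prems(1) by simp
  show ?case
  proof (rule Ck_on_SucI[OF \<open>open X\<close> D])
    show "Ck_on k X h" if "\<And>x. x \<in> X \<Longrightarrow> g x = h x" "Ck_on k X g" for g h :: "'a \<Rightarrow> 'b"
      using that by (rule Suc.IH)
    show "Ck_on k X (\<lambda>x. frechet_derivative f (at x) v)" for v
      using Suc.prems(2) unfolding Ck_on.simps(2) by blast
  qed
qed

lemma Ck_on_has_derivative:
  assumes "open X" "\<And>x. x \<in> X \<Longrightarrow> (f has_derivative f' x) (at x)"
    and "\<And>v. Ck_on k X (\<lambda>x. f' x v)"
  shows "Ck_on (Suc k) X f"
  by (rule Ck_on_SucI[OF assms(1,2) Ck_on_cong[OF assms(1)] assms(3)])

lemma Ck_on_real_has_derivativeD:
  fixes f :: "real \<Rightarrow> real"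
  assumes "Ck_on (Suc k) X f" "x \<in> X"
  shows "(f has_real_derivative frechet_derivative f (at x) 1) (at x)"
proof -
  let ?f' = "frechet_derivative f (at x)"
  have D: "(f has_derivative ?f') (at x)"
    using assms by (rule Ck_on_has_derivativeD)
  have "?f' v = ?f' 1 * v" for v
    using linear_scale[OF has_derivative_linear[OF D], of v 1] by simp
  then have "?f' = (*) (?f' 1)" by (rule ext)
  with D show ?thesis by (simp add: has_field_derivative_def)
qed

lemma Ck_on_SucD: "Ck_on (Suc k) X f \<Longrightarrow> Ck_on k X f"
proof (induction k arbitrary: f)
  case 0
  then have "f differentiable (at x)" if "x \<in> X" for x
    using that by simp
  then show ?case
    by (simp add: continuous_at_imp_continuous_on differentiable_imp_continuous_within)
next
  case (Suc k)
  note D = iffD1[OF Ck_on.simps(2) Suc.prems]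
  show ?case
    by (rule iffD2[OF Ck_on.simps(2)], intro conjI allI Suc.IH)
      (rule conjunct1[OF D], rule spec[OF conjunct2[OF D]])
qed

lemma Ck_on_imp_continuous_on: "Ck_on k X f \<Longrightarrow> continuous_on X f"
  by (induction k) (auto dest: Ck_on_SucD simp del: Ck_on.simps(2))

lemma Ck_on_subset: "Ck_on k X f \<Longrightarrow> Y \<subseteq> X \<Longrightarrow> Ck_on k Y f"
  by (induction k arbitrary: f) (auto simp: continuous_on_subset)

lemma Ck_on_const: "Ck_on k X (\<lambda>x. c)"
  by (induction k arbitrary: c) (auto simp: frechet_derivative_const)

lemma Ck_on_linear:
  assumes "open X" "bounded_linear f"
  shows "Ck_on k X f"
proof (cases k)
  case 0
  then show ?thesis using assms by (simp add: linear_continuous_on)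
next
  case (Suc n)
  then show ?thesis
    using Ck_on_has_derivative[OF assms(1), of f "\<lambda>_. f"] assms(2)
    by (simp add: bounded_linear_imp_has_derivative Ck_on_const)
qed

lemma Ck_on_add:
  assumes "open X" "Ck_on k X f" "Ck_on k X g"
  shows "Ck_on k X (\<lambda>x. f x + g x)"
  using assms(2,3)
proof (induction k arbitrary: f g)
  case (Suc k)
  show ?case
  proof (rule Ck_on_has_derivative[OF \<open>open X\<close>])
    show "((\<lambda>x. f x + g x) has_derivative
        (\<lambda>v. frechet_derivative f (at x) v + frechet_derivative g (at x) v)) (at x)" if "x \<in> X" for x
      by (intro has_derivative_add Suc.prems[THEN Ck_on_has_derivativeD] that)
    show "Ck_on k X (\<lambda>x. frechet_derivative f (at x) v + frechet_derivative g (at x) v)" for v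
      by (intro Suc.IH[OF Ck_on_frechet Ck_on_frechet] Suc.prems)
  qed
qed (simp add: continuous_on_add)

text \<open>The product rule gives two summands; in each, one factor is differentiated and the other
  merely loses one order by \<open>Ck_on_SucD\<close>, so the induction varies both functions.
  Products, scalar multiples and inner products are all instances.\<close>

lemma Ck_on_bilinear:
  assumes "open X" "bounded_bilinear B" "Ck_on k X f" "Ck_on k X g"
  shows "Ck_on k X (\<lambda>x. B (f x) (g x))"
  using assms(3,4)
proof (induction k arbitrary: f g)
  case 0
  then show ?case by (simp add: bounded_bilinear.continuous_on[OF assms(2)])
next
  case (Suc k)
  let ?D = "\<lambda>x v. B (f x) (frechet_derivative g (at x) v) + B (frechet_derivative f (at x) v) (g x)"
  show ?case
  proof (rule Ck_on_has_derivative[OF \<open>open X\<close>])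
    show "((\<lambda>x. B (f x) (g x)) has_derivative ?D x) (at x)" if "x \<in> X" for x
      by (intro bounded_bilinear.FDERIV[OF assms(2)] Suc.prems[THEN Ck_on_has_derivativeD] that)
    show "Ck_on k X (\<lambda>x. ?D x v)" for v
      by (intro Ck_on_add[OF \<open>open X\<close>] Suc.IH[OF Ck_on_SucD Ck_on_frechet] Suc.IH[OF Ck_on_frechet Ck_on_SucD] Suc.prems)
  qed
qed

lemmas Ck_on_mult = Ck_on_bilinear[OF _ bounded_bilinear_mult]
lemmas Ck_on_scaleR = Ck_on_bilinear[OF _ bounded_bilinear_scaleR]
lemmas Ck_on_inner = Ck_on_bilinear[OF _ bounded_bilinear_inner]

text \<open>By the chain rule the derivative is a product of \<open>g'\<close> and \<open>f'\<close>
  composed with the same \<open>g\<close>; hence the induction varies \<open>f\<close> and keeps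
  \<open>g\<close> fixed.\<close>

lemma Ck_on_compose_real:
  fixes f :: "real \<Rightarrow> real" and g :: "'a::euclidean_space \<Rightarrow> real"
  assumes "open X" "g ` X \<subseteq> Y" "Ck_on k Y f" "Ck_on k X g"
  shows "Ck_on k X (\<lambda>x. f (g x))"
  using assms(3,4,2)
proof (induction k arbitrary: f)
  case 0
  then show ?case
    unfolding Ck_on.simps(1) by (rule continuous_on_compose2)
next
  case (Suc k)
  let ?f' = "\<lambda>x. frechet_derivative f (at x) 1"
  have fd: "(f has_derivative (\<lambda>v. v * ?f' y)) (at y)" if "y \<in> Y" for y
    using Ck_on_real_has_derivativeD[OF Suc.prems(1) that]
    by (simp add: has_field_derivative_def mult_commute_abs)
  have "((\<lambda>x. f (g x)) has_derivative (\<lambda>v. frechet_derivative g (at x) v * ?f' (g x))) (at x)"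
    if "x \<in> X" for x
    using has_derivative_compose[OF Ck_on_has_derivativeD[OF Suc.prems(2) that] fd] Suc.prems(3) that
    by auto
  moreover have "Ck_on k X (\<lambda>x. ?f' (g x))"
    by (rule Suc.IH[OF Ck_on_frechet[OF Suc.prems(1)] Ck_on_SucD[OF Suc.prems(2)] Suc.prems(3)])
  then have "Ck_on k X (\<lambda>x. frechet_derivative g (at x) v * ?f' (g x))" for v
    by (rule Ck_on_mult[OF \<open>open X\<close> Ck_on_frechet[OF Suc.prems(2)]])
  ultimately show ?case
    by (rule Ck_on_has_derivative[OF \<open>open X\<close>])
qed

lemma Ck_on_has_real_derivative:
  fixes f f' :: "real \<Rightarrow> real"
  assumes "open X" "\<And>x. x \<in> X \<Longrightarrow> (f has_real_derivative f' x) (at x)" "Ck_on k X f'"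
  shows "Ck_on (Suc k) X f"
proof (rule Ck_on_has_derivative[OF assms(1)])
  show "(f has_derivative (*) (f' x)) (at x)" if "x \<in> X" for x
    using assms(2)[OF that] by (simp add: has_field_derivative_def)
  show "Ck_on k X (\<lambda>x. f' x * v)" for v
    by (rule Ck_on_mult[OF assms(1,3) Ck_on_const])
qed

lemma Ck_on_exp: "Ck_on k UNIV (exp :: real \<Rightarrow> real)"
proof (induction k)
  case (Suc k)
  show ?case
    by (rule Ck_on_has_real_derivative[OF open_UNIV DERIV_exp Suc])
qed (simp add: continuous_on_exp[OF continuous_on_id])

lemma Ck_on_inverse: "Ck_on k {0<..} (inverse :: real \<Rightarrow> real)"
proof (induction k)
  case (Suc k)
  have C: "Ck_on k {0<..} (\<lambda>x::real. -1 * (inverse x * inverse x))"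
    by (rule Ck_on_mult[OF _ Ck_on_const Ck_on_mult[OF _ Suc Suc]]) auto
  have "(inverse has_real_derivative -1 * (inverse x * inverse x)) (at x)"
    if "x \<in> {0<..}" for x :: real
    using DERIV_inverse[of x UNIV] that by simp
  then show ?case
    by (rule Ck_on_has_real_derivative[OF open_greaterThan _ C])
qed (simp add: continuous_on_inverse[OF continuous_on_id])

section \<open>Scaled integrals of class C^k\<close>

text \<open>Differentiating under the integral sign reproduces the same kind of integral, with
  \<open>g'\<close> for \<open>g\<close> and the weight \<open>w s * s\<close> for
  \<open>w s\<close>, so the induction varies the weight as well. Continuity of the weight suffices,
  which admits \<open>sqrt s ^ d\<close>.\<close>

lemma Ck_on_scaled_integral:
  fixes g w :: "real \<Rightarrow> real"
  assumes X: "open X" "convex X" "0 \<in> X"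
    and "continuous_on {0..1} w" "Ck_on k X g"
  shows "Ck_on k X (\<lambda>t. integral {0..1} (\<lambda>s. w s * g (t * s)))"
proof -
  have mem: "t * s \<in> X" if "t \<in> X" "0 \<le> s" "s \<le> 1" for t s
    using convexD[OF X(2) that(1) X(3), of s "1 - s"] that by (simp add: mult.commute)
  have cont: "continuous_on (X \<times> {0..1}) (\<lambda>(t, s). w s * g (t * s))"
    if "continuous_on {0..1} w" "continuous_on X g" for w g :: "real \<Rightarrow> real"
  proof -
    have "continuous_on (X \<times> {0..1}) (\<lambda>p. w (snd p))"
      by (rule continuous_on_compose2[OF that(1)]) (auto intro: continuous_on_snd)
    moreover have "continuous_on (X \<times> {0..1}) (\<lambda>p. g (fst p * snd p))"
      by (rule continuous_on_compose2[OF that(2)]) (auto intro!: continuous_intros mem)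
    ultimately show ?thesis
      unfolding split_beta by (rule continuous_on_mult)
  qed
  show ?thesis
    using assms(4,5)
  proof (induction k arbitrary: w g)
    case 0
    then show ?case
      unfolding Ck_on.simps(1)
      by (rule integral_continuous_on_param[of X 0 "1::real", unfolded box_real(2), OF cont])
  next
    case (Suc k)
    let ?g' = "\<lambda>x. frechet_derivative g (at x) 1"
    have gd: "(g has_real_derivative ?g' y) (at y)" if "y \<in> X" for y
      using Suc.prems(2) that by (rule Ck_on_real_has_derivativeD)
    have ck: "Ck_on k X ?g'" using Suc.prems(2) by (rule Ck_on_frechet)
    have "continuous_on X ?g'"
      using ck by (rule Ck_on_imp_continuous_on)
    have "continuous_on X g"
      using Suc.prems(2) by (rule Ck_on_imp_continuous_on)
    have w: "continuous_on {0..1} (\<lambda>s. w s * s)"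
      by (intro continuous_intros Suc.prems)
    have "((\<lambda>t. integral (cbox 0 1) (\<lambda>s. w s * g (t * s))) has_field_derivative
        integral (cbox 0 1) (\<lambda>s. (w s * s) * ?g' (t * s))) (at t within X)" if "t \<in> X" for t
    proof (rule leibniz_rule_field_derivative[OF _ _ _ that X(2)])
      fix t s :: real assume "t \<in> X" "s \<in> cbox 0 1"
      then have "t * s \<in> X" by (simp add: mem)
      then have "((\<lambda>t. g (t * s)) has_real_derivative ?g' (t * s) * s) (at t within X)"
        using DERIV_chain2[OF gd DERIV_cmult_right[OF DERIV_ident]] by simp
      from DERIV_cmult[OF this, of "w s"]
      show "((\<lambda>t. w s * g (t * s)) has_field_derivative (w s * s) * ?g' (t * s)) (at t within X)"
        by (simp add: mult_ac)
    next
      fix t assume "t \<in> X"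
      then have "continuous_on {0..1} (\<lambda>s. g (t * s))"
        by (intro continuous_on_compose2[OF \<open>continuous_on X g\<close>])
          (auto intro!: continuous_intros mem)
      then show "(\<lambda>s. w s * g (t * s)) integrable_on cbox 0 1"
        unfolding box_real(2)
        by (intro integrable_continuous_real continuous_on_mult Suc.prems)
    next
      show "continuous_on (X \<times> cbox 0 1) (\<lambda>(t, s). (w s * s) * ?g' (t * s))"
        unfolding box_real(2) by (rule cont[OF w \<open>continuous_on X ?g'\<close>])
    qed
    note D = this[unfolded box_real(2)]
    have "((\<lambda>t. integral {0..1} (\<lambda>s. w s * g (t * s))) has_real_derivative
        integral {0..1} (\<lambda>s. (w s * s) * ?g' (t * s))) (at t)" if "t \<in> X" for t
      by (rule D[OF that, unfolded at_within_open[OF that X(1)]])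
    then show ?case
      by (rule Ck_on_has_real_derivative[OF X(1) _ Suc.IH[OF w ck]])
  qed
qed

section \<open>Operations on smooth functions\<close>

lemma smooth_on_mult:
  fixes f g :: "'a::euclidean_space \<Rightarrow> 'b::real_normed_algebra"
  shows "open X \<Longrightarrow> smooth_on X f \<Longrightarrow> smooth_on X g \<Longrightarrow> smooth_on X (\<lambda>x. f x * g x)"
  unfolding smooth_on_def using Ck_on_mult by blast

lemma smooth_on_scaleR:
  "open X \<Longrightarrow> smooth_on X f \<Longrightarrow> smooth_on X g \<Longrightarrow> smooth_on X (\<lambda>x. f x *\<^sub>R g x)"
  unfolding smooth_on_def using Ck_on_scaleR by blast

lemma smooth_on_linear: "open X \<Longrightarrow> bounded_linear f \<Longrightarrow> smooth_on X f"
  unfolding smooth_on_def using Ck_on_linear by blast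

lemma smooth_on_subset: "smooth_on X f \<Longrightarrow> Y \<subseteq> X \<Longrightarrow> smooth_on Y f"
  unfolding smooth_on_def using Ck_on_subset by blast

lemma smooth_on_exp:
  fixes f :: "'a::euclidean_space \<Rightarrow> real"
  assumes "open X" "smooth_on X f"
  shows "smooth_on X (\<lambda>x. exp (f x))"
  using assms Ck_on_compose_real[OF assms(1) subset_UNIV Ck_on_exp]
  unfolding smooth_on_def by blast

text \<open>The norm is not smooth at the origin, but its square is an inner product, and its values
  lie in \<open>{0..}\<close>, well inside the domain of \<open>f\<close>. This is why the profiles
  are sought as functions of \<open>\<zeta>\<^sup>2\<close> that are smooth slightly beyond
  0.\<close>

lemma smooth_on_norm_square:
  fixes f :: "real \<Rightarrow> real"
  assumes "smooth_on {- \<delta><..} f" "\<delta> > 0"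
  shows "smooth_on UNIV (\<lambda>y :: 'a::euclidean_space. f ((norm y)\<^sup>2))"
  unfolding smooth_on_def
proof
  fix k
  have inner: "Ck_on k UNIV (\<lambda>y :: 'a. y \<bullet> y)"
    by (rule Ck_on_inner[OF open_UNIV]; rule Ck_on_linear[OF open_UNIV bounded_linear_ident])
  have "Ck_on k {- \<delta><..} f"
    using assms(1) by (simp add: smooth_on_def)
  moreover have "(\<lambda>y :: 'a. y \<bullet> y) ` UNIV \<subseteq> {- \<delta><..}"
    using assms(2) inner_ge_zero by (auto intro: less_le_trans[of "- \<delta>" 0])
  ultimately have "Ck_on k UNIV (\<lambda>y :: 'a. f (y \<bullet> y))"
    by (intro Ck_on_compose_real[OF open_UNIV _ _ inner])
  then show "Ck_on k UNIV (\<lambda>y :: 'a. f ((norm y)\<^sup>2))"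
    by (simp only: power2_norm_eq_inner)
qed

section \<open>Volterra equations\<close>

text \<open>The left-hand side equals \<open>(1 - exp (- K * \<bar>t\<bar>)) / K\<close> for
  \<open>t\<close> other than 0. This is the source of the factor \<open>1 / K\<close> in the
  contraction estimate below.\<close>

lemma weighted_exp_integral_bound:
  fixes K t :: real
  assumes "K > 0"
  shows "exp (- K * \<bar>t\<bar>) * (\<bar>t\<bar> * integral {0..1} (\<lambda>s. exp (K * \<bar>t\<bar> * s))) \<le> 1 / K"
proof (cases "t = 0")
  case True
  then show ?thesis using assms by simp
next
  case False
  define c where "c = K * \<bar>t\<bar>"
  have c: "c > 0" using False assms by (simp add: c_def)
  have "((\<lambda>s. exp (c * s)) has_integral (exp (c * 1) / c - exp (c * 0) / c)) {0..1}"
  proof (rule fundamental_theorem_of_calculus)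
    show "((\<lambda>s. exp (c * s) / c) has_vector_derivative exp (c * s)) (at s within {0..1})" for s
      unfolding has_real_derivative_iff_has_vector_derivative[symmetric]
      using c by (auto intro!: derivative_eq_intros)
  qed simp
  then have "integral {0..1} (\<lambda>s. exp (c * s)) = (exp c - 1) / c"
    by (simp add: integral_unique diff_divide_distrib)
  then have "exp (- c) * (\<bar>t\<bar> * integral {0..1} (\<lambda>s. exp (c * s))) = (1 - exp (- c)) / K"
    using c assms False by (simp add: c_def exp_minus divide_simps) (simp add: algebra_simps)
  also have "\<dots> \<le> 1 / K"
    using assms by (simp add: field_simps)
  finally show ?thesis
    by (simp add: c_def)
qed

lemma linear_times_exp_bound:
  fixes K t :: real
  assumes "K > 0"
  shows "exp (- K * \<bar>t\<bar>) * \<bar>t\<bar> \<le> 1 / K"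
proof -
  have "K * \<bar>t\<bar> \<le> exp (K * \<bar>t\<bar>)"
    using exp_ge_add_one_self[of "K * \<bar>t\<bar>"] by linarith
  then show ?thesis
    using assms by (simp add: exp_minus field_simps)
qed

text \<open>Volterra equations \<open>y(t) = c + \<integral>\<^sub>0\<^sup>t \<dots>\<close> with the integral scaled to \<open>[0,1]\<close>: in the norm
  \<open>sup e\<^bsup>-K|t|\<^esup>|y(t)|\<close> the Picard map contracts by the factor \<open>L/K\<close>, so one application of
  Banach's theorem yields a solution on the whole line.\<close>

lemma scaled_volterra_solution:
  fixes F :: "real \<Rightarrow> real \<Rightarrow> 'b::euclidean_space \<Rightarrow> 'b" and c :: 'b
  assumes cont: "continuous_on ({0..1} \<times> UNIV) (\<lambda>(s, t, y). F s t y)"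
    and bound: "\<And>s t y. s \<in> {0..1} \<Longrightarrow> norm (F s t y) \<le> B"
    and lip: "\<And>s t y z. s \<in> {0..1} \<Longrightarrow> norm (F s t y - F s t z) \<le> L * norm (y - z)"
  shows "\<exists>y. continuous_on UNIV y \<and>
    (\<forall>t. y t = c + t *\<^sub>R integral {0..1} (\<lambda>s. F s (t * s) (y (t * s))))"
proof -
  \<comment> \<open>This \<open>K\<close> is positive and gives the contraction factor
    \<open>\<bar>L\<bar> / K\<close> at most 1/2, whatever the sign of \<open>L\<close>.\<close>
  define K where "K = 2 * \<bar>L\<bar> + 2"
  have K: "K > 0" "\<bar>L\<bar> / K \<le> 1 / 2" by (auto simp: K_def field_simps)
  have B: "B \<ge> 0" by (rule order_trans[OF norm_ge_zero bound[of 0 0 0]]) simp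
  \<comment> \<open>The unknown is stored as
    \<open>z t = exp (- K * \<bar>t\<bar>) (y t - c)\<close>, so that the weighted norm becomes the
    sup norm on the complete space of bounded continuous functions.\<close>
  define Y where "Y z t = c + exp (K * \<bar>t\<bar>) *\<^sub>R apply_bcontfun z t" for z :: "real \<Rightarrow>\<^sub>C 'b" and t
  define I where "I z t = integral {0..1} (\<lambda>s. F s (t * s) (Y z (t * s)))" for z t
  have Y: "continuous_on UNIV (Y z)" for z
    unfolding Y_def by (intro continuous_intros continuous_on_apply_bcontfun)
  have cF: "continuous_on (X \<times> {0..1}) (\<lambda>(t, s). F s (t * s) (Y z (t * s)))" for z X
  proof -
    have "continuous_on (X \<times> {0..1}) (\<lambda>p. Y z (fst p * snd p))"
      by (rule continuous_on_compose2[OF Y]) (auto intro!: continuous_intros)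
    then have "continuous_on (X \<times> {0..1}) (\<lambda>p. (snd p, fst p * snd p, Y z (fst p * snd p)))"
      by (intro continuous_on_Pair continuous_on_mult continuous_on_fst continuous_on_snd continuous_on_id)
    from continuous_on_compose2[OF cont this]
    show ?thesis by (simp add: split_beta image_subset_iff)
  qed
  have I: "continuous_on UNIV (I z)" for z
    unfolding I_def by (rule integral_continuous_on_param[of UNIV 0 "1::real", unfolded box_real(2), OF cF])
  have int: "(\<lambda>s. F s (t * s) (Y z (t * s))) integrable_on {0..1}" for z t
  proof (rule integrable_continuous_real)
    have "continuous_on {0..1} (\<lambda>s. (t, s))" by (intro continuous_intros)
    from continuous_on_compose2[OF cF[of "{t}" z] this]
    show "continuous_on {0..1} (\<lambda>s. F s (t * s) (Y z (t * s)))" by (simp add: image_subset_iff)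
  qed
  have nI: "norm (I z t) \<le> B" for z t
    using integral_norm_bound_integral[OF int[of t z] integrable_const_ivl[of B 0 1]] bound
    by (auto simp: I_def)
  define T where "T z = Bcontfun (\<lambda>t. exp (- K * \<bar>t\<bar>) *\<^sub>R (t *\<^sub>R I z t))" for z
  have T: "apply_bcontfun (T z) = (\<lambda>t. exp (- K * \<bar>t\<bar>) *\<^sub>R (t *\<^sub>R I z t))" for z
    unfolding T_def
  proof (intro Bcontfun_inverse bcontfun_normI)
    show "continuous_on UNIV (\<lambda>t. exp (- K * \<bar>t\<bar>) *\<^sub>R (t *\<^sub>R I z t))"
      by (intro continuous_intros I)
    fix t
    have "norm (exp (- K * \<bar>t\<bar>) *\<^sub>R (t *\<^sub>R I z t)) = (exp (- K * \<bar>t\<bar>) * \<bar>t\<bar>) * norm (I z t)"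
      by (simp add: abs_mult)
    also have "\<dots> \<le> (1 / K) * B"
      using K(1) B by (intro mult_mono linear_times_exp_bound nI) auto
    finally show "norm (exp (- K * \<bar>t\<bar>) *\<^sub>R (t *\<^sub>R I z t)) \<le> (1 / K) * B" .
  qed
  have "dist (T z) (T z') \<le> 1 / 2 * dist z z'" for z z'
  proof (rule dist_bound)
    fix t
    have "norm (I z t - I z' t) \<le> integral {0..1} (\<lambda>s. \<bar>L\<bar> * dist z z' * exp (K * \<bar>t\<bar> * s))"
      unfolding I_def integral_diff[OF int int, symmetric]
    proof (rule integral_norm_bound_integral)
      show "(\<lambda>s. F s (t * s) (Y z (t * s)) - F s (t * s) (Y z' (t * s))) integrable_on {0..1}"
        by (intro integrable_diff int)
      show "(\<lambda>s. \<bar>L\<bar> * dist z z' * exp (K * \<bar>t\<bar> * s)) integrable_on {0..1}"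
        by (intro integrable_continuous_real continuous_intros)
      fix s :: real assume s: "s \<in> {0..1}"
      have "norm (F s (t * s) (Y z (t * s)) - F s (t * s) (Y z' (t * s)))
          \<le> \<bar>L\<bar> * norm (Y z (t * s) - Y z' (t * s))"
        using lip[OF s] by (rule order_trans) (simp add: mult_right_mono)
      \<comment> \<open>As \<open>s\<close> is nonnegative, the weight at the point
        \<open>t * s\<close> is \<open>exp (K * \<bar>t\<bar> * s)\<close>, the integrand of
        \<open>weighted_exp_integral_bound\<close>.\<close>
      also have "Y z (t * s) - Y z' (t * s) = exp (K * \<bar>t\<bar> * s) *\<^sub>R (apply_bcontfun z (t * s) - apply_bcontfun z' (t * s))"
        using s by (simp add: Y_def abs_mult algebra_simps)
      also have "\<bar>L\<bar> * norm \<dots> \<le> \<bar>L\<bar> * (exp (K * \<bar>t\<bar> * s) * dist z z')"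
        using dist_bounded[of z "t * s" z'] by (intro mult_left_mono) (simp_all add: dist_norm)
      finally show "norm (F s (t * s) (Y z (t * s)) - F s (t * s) (Y z' (t * s)))
          \<le> \<bar>L\<bar> * dist z z' * exp (K * \<bar>t\<bar> * s)"
        by (simp add: mult_ac)
    qed
    then have nd: "norm (I z t - I z' t) \<le> \<bar>L\<bar> * dist z z' * integral {0..1} (\<lambda>s. exp (K * \<bar>t\<bar> * s))"
      by simp
    have "dist (apply_bcontfun (T z) t) (apply_bcontfun (T z') t)
        = exp (- K * \<bar>t\<bar>) * (\<bar>t\<bar> * norm (I z t - I z' t))"
      unfolding T dist_norm by (simp add: abs_mult flip: scaleR_diff_right)
    also have "\<dots> \<le> exp (- K * \<bar>t\<bar>) * (\<bar>t\<bar> * (\<bar>L\<bar> * dist z z' * integral {0..1} (\<lambda>s. exp (K * \<bar>t\<bar> * s))))"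
      by (intro mult_left_mono nd) auto
    also have "\<dots> = \<bar>L\<bar> * dist z z' * (exp (- K * \<bar>t\<bar>) * (\<bar>t\<bar> * integral {0..1} (\<lambda>s. exp (K * \<bar>t\<bar> * s))))"
      by (simp add: mult_ac)
    also have "\<dots> \<le> \<bar>L\<bar> * dist z z' * (1 / K)"
      by (intro mult_left_mono weighted_exp_integral_bound K) auto
    also have "\<dots> = \<bar>L\<bar> / K * dist z z'" by simp
    also have "\<dots> \<le> 1 / 2 * dist z z'"
      by (intro mult_right_mono K) auto
    finally show "dist (apply_bcontfun (T z) t) (apply_bcontfun (T z') t) \<le> 1 / 2 * dist z z'" .
  qed
  then obtain z where z: "T z = z"
    using banach_fix_type[of "1 / 2" T] by auto
  have "Y z t = c + t *\<^sub>R I z t" for t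
  proof -
    have "exp (K * \<bar>t\<bar>) *\<^sub>R apply_bcontfun z t = exp (K * \<bar>t\<bar>) *\<^sub>R apply_bcontfun (T z) t"
      by (simp only: z)
    also have "\<dots> = t *\<^sub>R I z t"
      unfolding T by (simp flip: exp_add mult.assoc)
    finally show ?thesis by (simp add: Y_def)
  qed
  then show ?thesis
    using Y[of z] unfolding I_def by blast
qed

section \<open>The weighted average that resolves the singular term\<close>

lemma DERIV_sqrt_power:
  assumes "t > 0"
  shows "((\<lambda>s. sqrt s ^ d) has_real_derivative real d / 2 * sqrt t ^ d / t) (at t)"
proof -
  define u where "u = sqrt t"
  have u: "u > 0" "t = u * u"
    using assms by (auto simp: u_def)
  have "((\<lambda>s. sqrt s ^ d) has_real_derivative real d * u ^ (d - 1) * (inverse u / 2)) (at t)"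
    using DERIV_power[OF DERIV_real_sqrt[OF assms], of d] by (simp add: u_def mult_ac)
  also have "real d * u ^ (d - 1) * (inverse u / 2) = real d / 2 * u ^ d / t"
    using u by (cases d) (auto simp: field_simps)
  finally show ?thesis by (simp add: u_def)
qed

lemma integral_sqrt_power: "integral {0..1} (\<lambda>s. sqrt s ^ d) = 1 / (1 + real d / 2)"
proof (rule integral_unique)
  let ?F = "\<lambda>s. s * sqrt s ^ d / (1 + real d / 2)"
  have "((\<lambda>s. sqrt s ^ d) has_integral (?F 1 - ?F 0)) {0..1}"
  \<comment> \<open>Since \<open>sqrt\<close> is not differentiable at 0, the derivative is computed
    in the interior only.\<close>
  proof (rule fundamental_theorem_of_calculus_interior)
    fix s :: real assume s: "s \<in> {0<..<1}"
    then have "s > 0" by simp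
    from DERIV_cdivide[OF DERIV_mult[OF DERIV_ident DERIV_sqrt_power[OF this]], of d "1 + real d / 2"]
    have "(?F has_real_derivative sqrt s ^ d) (at s)"
      by (rule DERIV_cong) (use \<open>s > 0\<close> in \<open>simp add: field_simps\<close>)
    then show "(?F has_vector_derivative sqrt s ^ d) (at s)"
      by (simp add: has_real_derivative_iff_has_vector_derivative)
  qed (auto intro!: continuous_intros)
  then show "((\<lambda>s. sqrt s ^ d) has_integral 1 / (1 + real d / 2)) {0..1}"
    by simp
qed

text \<open>With \<open>J t\<close> the integral of \<open>s^(d/2) g(s)\<close> over
  \<open>{0..t}\<close>, substitution gives \<open>t * m t = J t / t^(d/2)\<close>, and the quotient
  rule yields the claim. Thus \<open>f t = t * m t\<close> solves
  \<open>t f' = t g - (d/2) f\<close>.\<close>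

lemma scaled_integral_power_has_derivative_pos:
  fixes g :: "real \<Rightarrow> real" and d :: nat
  assumes g: "continuous_on UNIV g" and "t > 0"
  defines "m \<equiv> \<lambda>t. integral {0..1} (\<lambda>s. sqrt s ^ d * g (t * s))"
  shows "((\<lambda>t. t * m t) has_real_derivative g t - real d / 2 * m t) (at t)"
proof -
  define J where "J t = integral {0..t} (\<lambda>s. sqrt s ^ d * g s)" for t
  have cont: "continuous_on X (\<lambda>s. sqrt s ^ d * g s)" for X
    by (intro continuous_intros continuous_on_subset[OF g]) auto
  have scaled: "x * m x = J x / sqrt x ^ d" if "x > 0" for x
  proof -
    have "((\<lambda>s. sqrt s ^ d * g s) has_integral J x) {0..x}"
      unfolding J_def by (intro integrable_integral integrable_continuous_real cont)
    from has_integral_stretch_real[OF this, of x]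
    have "((\<lambda>s. sqrt x ^ d * (sqrt s ^ d * g (x * s))) has_integral J x / x) ((\<lambda>y. y / x) ` {0..x})"
      using that by (simp add: real_sqrt_mult power_mult_distrib mult_ac divide_inverse)
    also have "(\<lambda>y. y / x) ` {0..x} = {0..1}"
      using that by (auto simp: image_iff field_simps intro!: bexI[of _ "x * _"])
    finally have "integral {0..1} (\<lambda>s. sqrt x ^ d * (sqrt s ^ d * g (x * s))) = J x / x"
      by (rule integral_unique)
    then have "sqrt x ^ d * m x = J x / x"
      by (simp add: m_def)
    then show ?thesis
      using that by (simp add: field_simps)
  qed
  have "(J has_real_derivative sqrt t ^ d * g t) (at t within {0..t + 1})"
    unfolding J_def
    using \<open>t > 0\<close> by (intro integral_has_real_derivative cont) auto
  then have J': "(J has_real_derivative sqrt t ^ d * g t) (at t)"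
    using \<open>t > 0\<close> by (simp add: at_within_Icc_at)
  have "((\<lambda>x. J x / sqrt x ^ d) has_real_derivative g t - real d / 2 * (J t / sqrt t ^ d / t)) (at t)"
    by (rule DERIV_cong[OF DERIV_divide[OF J' DERIV_sqrt_power]])
      (use \<open>t > 0\<close> in \<open>auto simp: field_simps\<close>)
  also have "J t / sqrt t ^ d / t = m t"
    using scaled[OF \<open>t > 0\<close>] \<open>t > 0\<close> by (simp add: field_simps)
  finally show ?thesis
    by (rule has_field_derivative_transform_within_open[of _ _ _ "{0<..}"])
      (use scaled \<open>t > 0\<close> in auto)
qed

text \<open>Negative \<open>t\<close> reduces to positive \<open>t\<close> by reflecting
  \<open>g\<close>. At 0 the difference quotient is \<open>m\<close> itself, which is continuous,
  and \<open>m 0 = g 0 / (1 + d/2)\<close> is exactly the value for which the formula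
  persists.\<close>

lemma scaled_integral_power_has_derivative:
  fixes g :: "real \<Rightarrow> real" and d :: nat
  assumes g: "continuous_on UNIV g"
  defines "m \<equiv> \<lambda>t. integral {0..1} (\<lambda>s. sqrt s ^ d * g (t * s))"
  shows "((\<lambda>t. t * m t) has_real_derivative g t - real d / 2 * m t) (at t)"
proof -
  consider "t > 0" | "t < 0" | "t = 0" by linarith
  then show ?thesis
  proof cases
    case 1
    then show ?thesis
      unfolding m_def by (rule scaled_integral_power_has_derivative_pos[OF g])
  next
    case 2
    let ?m = "\<lambda>t. integral {0..1} (\<lambda>s. sqrt s ^ d * g (- (t * s)))"
    have "continuous_on UNIV (\<lambda>x. g (- x))"
      by (intro continuous_on_compose2[OF g] continuous_intros) auto
    from scaled_integral_power_has_derivative_pos[OF this, of "- t" d]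
    have "((\<lambda>t. t * ?m t) has_real_derivative g t - real d / 2 * m t) (at (- t))"
      using 2 by (simp add: m_def)
    from DERIV_minus[OF DERIV_chain2[OF this DERIV_minus[OF DERIV_ident]]]
    show ?thesis
      by (simp add: m_def)
  next
    case 3
    have "continuous_on (UNIV \<times> {0..1}) (\<lambda>p. g (fst p * snd p))"
      by (rule continuous_on_compose2[OF g]) (auto intro!: continuous_intros)
    then have "continuous_on (UNIV \<times> {0..1}) (\<lambda>(t, s). sqrt s ^ d * g (t * s))"
      unfolding split_beta by (intro continuous_on_mult continuous_intros)
    then have "continuous_on UNIV m"
      unfolding m_def by (rule integral_continuous_on_param[of UNIV 0 "1::real", unfolded box_real(2)])
    then have "(m \<longlongrightarrow> m 0) (at 0)"
      by (simp add: continuous_on_def)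
    then have "((\<lambda>t. t * m t) has_real_derivative m 0) (at 0)"
      unfolding CARAT_DERIV by (intro exI[of _ m]) (simp add: isCont_def)
    moreover have "m 0 = g 0 / (1 + real d / 2)"
      by (simp add: m_def integral_sqrt_power)
    then have "m 0 = g 0 - real d / 2 * m 0"
      by (simp add: field_simps)
    ultimately show ?thesis
      using 3 by simp
  qed
qed

section \<open>Comparison arguments: barriers and decay\<close>

text \<open>If \<open>f t > c\<close>, take the last time \<open>s\<close> before \<open>t\<close>
  with \<open>f s \<le> c\<close>. Beyond \<open>s\<close> the function exceeds \<open>c\<close>, so
  its derivative is nonpositive there, and the mean value theorem on \<open>{s..t}\<close> gives a
  contradiction.\<close>

lemma bounded_above_by_barrier:
  fixes f f' :: "real \<Rightarrow> real"
  assumes "\<And>t. (f has_real_derivative f' t) (at t)" "f 0 \<le> c"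
    and "\<And>t. t > 0 \<Longrightarrow> f t \<ge> c \<Longrightarrow> f' t \<le> 0" "t \<ge> 0"
  shows "f t \<le> c"
proof (rule ccontr)
  assume "\<not> f t \<le> c"
  have cont: "continuous_on X f" for X
    using assms(1) by (meson DERIV_continuous continuous_at_imp_continuous_on)
  define A where "A = {s \<in> {0..t}. f s \<le> c}"
  have A: "compact A"
    unfolding A_def using continuous_closed_preimage[OF cont, of "{0..t}" "{..c}"]
    by (auto simp: compact_eq_bounded_closed vimage_def Int_def intro: bounded_subset[of "{0..t}"])
  have "A \<noteq> {}"
    using assms(2,4) by (auto simp: A_def)
  with A obtain s where s: "s \<in> A" "\<And>x. x \<in> A \<Longrightarrow> x \<le> s"
    by (meson compact_attains_sup)
  have "s < t"
    using s(1) \<open>\<not> f t \<le> c\<close> by (cases "s = t") (auto simp: A_def)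
  obtain z where z: "s < z" "z < t" "f t - f s = (t - s) * f' z"
    using MVT2[OF \<open>s < t\<close>, of f f'] assms(1) by blast
  have "z \<notin> A"
    using s(2)[of z] z(1) by auto
  then have "f z \<ge> c"
    using s(1) z by (simp add: A_def)
  then have "f' z \<le> 0"
    using s(1) z by (intro assms(3)) (auto simp: A_def)
  then have "(t - s) * f' z \<le> 0"
    using \<open>s < t\<close> by (intro mult_nonneg_nonpos) auto
  then show False
    using s(1) z \<open>\<not> f t \<le> c\<close> by (simp add: A_def)
qed

text \<open>The inequality says that \<open>x powr c * f x\<close> is nonincreasing, which bounds
  \<open>f x\<close> by \<open>f 1 * x powr (- c)\<close>.\<close>

lemma tendsto_zero_of_euler_inequality:
  fixes f f' :: "real \<Rightarrow> real"
  assumes D: "\<And>x. x \<ge> 1 \<Longrightarrow> (f has_real_derivative f' x) (at x)"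
    and ineq: "\<And>x. x \<ge> 1 \<Longrightarrow> x * f' x \<le> - c * f x"
    and "\<And>x. x \<ge> 1 \<Longrightarrow> f x \<ge> 0" "c > 0"
  shows "(f \<longlongrightarrow> 0) at_top"
proof (rule real_tendsto_sandwich[of "\<lambda>_. 0" f at_top "\<lambda>x. f 1 * x powr (- c)"])
  have "x powr c * f x \<le> 1 powr c * f 1" if "x \<ge> 1" for x
  proof (rule DERIV_nonpos_imp_nonincreasing[OF that, of "\<lambda>x. x powr c * f x"])
    fix y :: real assume y: "1 \<le> y" "y \<le> x"
    have "((\<lambda>x. x powr c * f x) has_real_derivative
        y powr c * f' y + c * y powr (c - 1) * f y) (at y)"
      using y by (auto intro!: derivative_eq_intros D[OF y(1)])
    moreover have "y powr c * f' y + c * y powr (c - 1) * f y = y powr (c - 1) * (y * f' y + c * f y)"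
      using y by (simp add: powr_diff field_simps)
    moreover have "\<dots> \<le> 0"
      using ineq[OF y(1)] by (intro mult_nonneg_nonpos) auto
    ultimately show "\<exists>z. ((\<lambda>x. x powr c * f x) has_real_derivative z) (at y) \<and> z \<le> 0"
      by auto
  qed
  then have "f x \<le> f 1 * x powr (- c)" if "x \<ge> 1" for x
    using that by (simp add: powr_minus field_simps)
  then show "\<forall>\<^sub>F x in at_top. f x \<le> f 1 * x powr (- c)"
    by (rule eventually_mono[OF eventually_ge_at_top])
  show "\<forall>\<^sub>F x in at_top. 0 \<le> f x"
    by (rule eventually_mono[OF eventually_ge_at_top assms(3)])
  have "((\<lambda>x::real. x powr (- c)) \<longlongrightarrow> 0) at_top"
    using \<open>c > 0\<close> by (intro tendsto_neg_powr filterlim_ident) auto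
  then show "((\<lambda>x. f 1 * x powr (- c)) \<longlongrightarrow> 0) at_top"
    by (rule tendsto_mult_right_zero)
qed auto

section \<open>Bounded Lipschitz nonlinearities\<close>

text \<open>The constants are uniform in the parameter \<open>t\<close>, as a solution on the whole
  line requires. Boundedness is included so that the class is closed under products.\<close>

definition bdd_lipschitz :: "('p \<Rightarrow> 'b::real_normed_vector \<Rightarrow> real) \<Rightarrow> bool" where
  "bdd_lipschitz f \<longleftrightarrow>
     (\<exists>B L. \<forall>t y z. \<bar>f t y\<bar> \<le> B \<and> \<bar>f t y - f t z\<bar> \<le> L * norm (y - z))"

lemma bdd_lipschitzE:
  assumes "bdd_lipschitz f"
  obtains B L where "B \<ge> 0" "L \<ge> 0" "\<And>t y. \<bar>f t y\<bar> \<le> B"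
    "\<And>t y z. \<bar>f t y - f t z\<bar> \<le> L * norm (y - z)"
proof -
  obtain B L where *: "\<And>t y. \<bar>f t y\<bar> \<le> B" "\<And>t y z. \<bar>f t y - f t z\<bar> \<le> L * norm (y - z)"
    using assms unfolding bdd_lipschitz_def by blast
  show ?thesis
  proof (rule that[of "\<bar>B\<bar>" "\<bar>L\<bar>"])
    show "\<bar>f t y\<bar> \<le> \<bar>B\<bar>" for t y using *(1)[of t y] by linarith
    show "\<bar>f t y - f t z\<bar> \<le> \<bar>L\<bar> * norm (y - z)" for t y z
      using *(2) by (rule order_trans) (simp add: mult_right_mono)
  qed auto
qed

lemma bdd_lipschitz_const: "bdd_lipschitz (\<lambda>t y. c)"
  unfolding bdd_lipschitz_def by (intro exI[of _ "\<bar>c\<bar>"] exI[of _ 0]) auto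

lemma bdd_lipschitz_add:
  assumes "bdd_lipschitz f" "bdd_lipschitz g"
  shows "bdd_lipschitz (\<lambda>t y. f t y + g t y)"
proof -
  obtain B L where f: "\<And>t y. \<bar>f t y\<bar> \<le> B" "\<And>t y z. \<bar>f t y - f t z\<bar> \<le> L * norm (y - z)"
    using bdd_lipschitzE[OF assms(1)] by metis
  obtain B' L' where g: "\<And>t y. \<bar>g t y\<bar> \<le> B'" "\<And>t y z. \<bar>g t y - g t z\<bar> \<le> L' * norm (y - z)"
    using bdd_lipschitzE[OF assms(2)] by metis
  show ?thesis
    unfolding bdd_lipschitz_def
  proof (rule exI[of _ "B + B'"], rule exI[of _ "L + L'"], intro allI conjI)
    show "\<bar>f t y + g t y\<bar> \<le> B + B'" for t y
      using f(1)[of t y] g(1)[of t y] by linarith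
    show "\<bar>f t y + g t y - (f t z + g t z)\<bar> \<le> (L + L') * norm (y - z)" for t y z
      using f(2)[of t y z] g(2)[of t y z] unfolding distrib_right by linarith
  qed
qed

lemma bdd_lipschitz_mult:
  assumes "bdd_lipschitz f" "bdd_lipschitz g"
  shows "bdd_lipschitz (\<lambda>t y. f t y * g t y)"
proof -
  obtain B L where f: "B \<ge> 0" "\<And>t y. \<bar>f t y\<bar> \<le> B" "\<And>t y z. \<bar>f t y - f t z\<bar> \<le> L * norm (y - z)"
    using bdd_lipschitzE[OF assms(1)] by metis
  obtain B' L' where g: "B' \<ge> 0" "\<And>t y. \<bar>g t y\<bar> \<le> B'" "\<And>t y z. \<bar>g t y - g t z\<bar> \<le> L' * norm (y - z)"
    using bdd_lipschitzE[OF assms(2)] by metis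
  show ?thesis
    unfolding bdd_lipschitz_def
  proof (rule exI[of _ "B * B'"], rule exI[of _ "B * L' + B' * L"], intro allI conjI)
    show "\<bar>f t y * g t y\<bar> \<le> B * B'" for t y
      unfolding abs_mult by (intro mult_mono f g) auto
    fix t y z
    have "\<bar>f t y * g t y - f t z * g t z\<bar> = \<bar>f t y * (g t y - g t z) + g t z * (f t y - f t z)\<bar>"
      by (simp add: algebra_simps)
    also have "\<dots> \<le> \<bar>f t y\<bar> * \<bar>g t y - g t z\<bar> + \<bar>g t z\<bar> * \<bar>f t y - f t z\<bar>"
      by (rule order_trans[OF abs_triangle_ineq]) (simp add: abs_mult)
    also have "\<dots> \<le> B * (L' * norm (y - z)) + B' * (L * norm (y - z))"
      by (intro add_mono mult_mono f g) auto
    finally show "\<bar>f t y * g t y - f t z * g t z\<bar> \<le> (B * L' + B' * L) * norm (y - z)"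
      by (simp add: algebra_simps)
  qed
qed

lemma exp_diff_le:
  fixes x y c :: real
  assumes "x \<le> c" "y \<le> c"
  shows "\<bar>exp x - exp y\<bar> \<le> exp c * \<bar>x - y\<bar>"
proof -
  have *: "exp x - exp y \<le> exp c * \<bar>x - y\<bar>" if "x \<le> c" for x y :: real
  proof -
    have "exp x - exp y = exp x * (1 - exp (y - x))"
      by (simp add: exp_diff algebra_simps)
    also have "\<dots> \<le> exp x * \<bar>x - y\<bar>"
    proof (intro mult_left_mono)
      show "1 - exp (y - x) \<le> \<bar>x - y\<bar>"
        using exp_ge_add_one_self[of "y - x"] by linarith
    qed simp
    also have "\<dots> \<le> exp c * \<bar>x - y\<bar>"
      using that by (intro mult_right_mono) auto
    finally show ?thesis .
  qed
  show ?thesis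
    using *[OF assms(1), of y] *[OF assms(2), of x] by (simp add: abs_le_iff abs_minus_commute)
qed

section \<open>The profile equations\<close>

locale elliptic_profile =
  fixes d :: nat and r \<alpha> :: real
  assumes r: "r > 1" and \<alpha>: "\<alpha> > 0" and supercritical: "\<alpha> * real d > r - 1"
begin

text \<open>In the variables \<open>t = \<zeta>\<^sup>2\<close>, \<open>U = \<zeta> u(t)\<close>, \<open>S = exp (l(t))\<close> the system reads
  \<open>2 t u' = - d (u - u0) + t P(u) / E(t, u, l)\<close> and \<open>2 l' = N(u) / E(t, u, l)\<close>, where \<open>E\<close> is
  the determinant \<open>(\<zeta> + U)\<^sup>2 + \<alpha>\<^sup>2 S\<^sup>2\<close> of the system viewed as linear in \<open>(U', S')\<close>.\<close>

definition u0 :: real where "u0 = - (r - 1) / (\<alpha> * real d)"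
definition P :: "real \<Rightarrow> real" where
  "P x = (1 + x)\<^sup>2 * (real d * (x - u0)) - (1 + x) * x * (r + x)"
definition N :: "real \<Rightarrow> real" where
  "N x = (1 + x) * (\<alpha> * real d * (u0 - x)) + \<alpha> * x * (r + x)"
definition E :: "real \<Rightarrow> real \<Rightarrow> real \<Rightarrow> real" where
  "E t x l = t * (1 + x)\<^sup>2 + \<alpha>\<^sup>2 * exp (2 * l)"

text \<open>The lower level is the midpoint of -1 and \<open>u0\<close>: it keeps
  \<open>1 + clamp_u x\<close> above a positive constant and leaves the strip from \<open>u0\<close>
  to 0 strictly inside the region where nothing is clamped.\<close>

definition clamp_u :: "real \<Rightarrow> real" where "clamp_u x = max ((u0 - 1) / 2) (min 1 x)"
text \<open>The floor \<open>\<epsilon>\<close> permits division, the cut of \<open>l\<close> makes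
  the exponential Lipschitz, and the cut of \<open>t\<close> excludes large negative multiples of
  the square. For \<open>t \<ge> 0\<close>, \<open>u\<close> in the strip and
  \<open>l \<le> 0\<close>, only the floor can be active.\<close>

definition E_cut :: "real \<Rightarrow> real \<Rightarrow> real \<Rightarrow> real \<Rightarrow> real" where
  "E_cut \<epsilon> t x l = max \<epsilon> (E (max t (- 1)) (clamp_u x) (min l 1))"

lemma d: "real d > 0"
  using r supercritical by (cases d) auto

lemma u0: "- 1 < u0" "u0 < 0" "\<alpha> * real d * u0 = 1 - r"
  using r supercritical \<alpha> d by (auto simp: u0_def field_simps)

lemma clamp_u: "(u0 - 1) / 2 \<le> clamp_u x" "clamp_u x \<le> 1" "\<bar>clamp_u x\<bar> \<le> 1" "0 < 1 + clamp_u x"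
proof -
  show "(u0 - 1) / 2 \<le> clamp_u x" "clamp_u x \<le> 1"
    using u0 by (auto simp: clamp_u_def)
  then show "\<bar>clamp_u x\<bar> \<le> 1" "0 < 1 + clamp_u x"
    using u0(1) by (auto simp: abs_le_iff)
qed

text \<open>Both summands are nonpositive. At \<open>x = 0\<close> the first is
  \<open>1 - r\<close>, and elsewhere the second is strictly negative. This sign makes
  \<open>S\<close> decrease.\<close>

lemma N_neg: "u0 \<le> x \<Longrightarrow> x \<le> 0 \<Longrightarrow> N x < 0"
proof -
  assume x: "u0 \<le> x" "x \<le> 0"
  have 1: "(1 + x) * (\<alpha> * real d * (u0 - x)) \<le> 0"
    using x u0 \<alpha> d by (intro mult_nonneg_nonpos) (auto intro!: mult_nonneg_nonpos)
  show ?thesis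
  proof (cases "x = 0")
    case True
    then show ?thesis using u0 r by (simp add: N_def)
  next
    case False
    then have "\<alpha> * x * (r + x) < 0"
      using x u0 \<alpha> r by (intro mult_neg_pos mult_pos_neg) auto
    then show ?thesis using 1 by (simp add: N_def)
  qed
qed

section \<open>Global solvability of the truncated system\<close>

lemma bdd_lipschitz_clamp_u:
  "bdd_lipschitz (\<lambda>t :: 'p. \<lambda>y :: real \<times> real. clamp_u (fst y))"
  unfolding bdd_lipschitz_def
proof (rule exI[of _ 1], rule exI[of _ 1], intro allI conjI clamp_u)
  fix t :: 'p and y z :: "real \<times> real"
  have "\<bar>clamp_u (fst y) - clamp_u (fst z)\<bar> \<le> \<bar>fst y - fst z\<bar>"
    by (auto simp: clamp_u_def)
  also have "\<dots> \<le> norm (y - z)"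
    using norm_fst_le[of "fst (y - z)" "snd (y - z)"] by (simp del: fst_diff snd_diff) (simp add: fst_diff)
  finally show "\<bar>clamp_u (fst y) - clamp_u (fst z)\<bar> \<le> 1 * norm (y - z)" by simp
qed

text \<open>The Lipschitz constant of \<open>E_cut\<close> itself grows with \<open>t\<close>. But
  \<open>E_cut\<close> also dominates a multiple of \<open>t\<close>, so its increments are at most
  a constant times \<open>norm (y - z)\<close> times \<open>E_cut\<close>, and this last factor
  cancels in the difference of the reciprocals.\<close>

lemma bdd_lipschitz_inverse_E_cut:
  assumes "\<epsilon> > 0"
  shows "bdd_lipschitz (\<lambda>t y. inverse (E_cut \<epsilon> t (fst y) (snd y)))"
proof -
  have "bdd_lipschitz (\<lambda>t::unit. \<lambda>y :: real \<times> real. (1 + clamp_u (fst y)) * (1 + clamp_u (fst y)))"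
    by (intro bdd_lipschitz_mult bdd_lipschitz_add bdd_lipschitz_const bdd_lipschitz_clamp_u)
  then obtain L where L: "L \<ge> 0" and q: "\<And>y z :: real \<times> real.
      \<bar>(1 + clamp_u (fst y))\<^sup>2 - (1 + clamp_u (fst z))\<^sup>2\<bar> \<le> L * norm (y - z)"
    unfolding power2_eq_square by (rule bdd_lipschitzE) blast
  define \<kappa> where "\<kappa> = (1 + u0) / 2"
  have \<kappa>: "\<kappa> > 0" using u0 by (simp add: \<kappa>_def)
  \<comment> \<open>The first summand serves \<open>t \<le> 1\<close>, where the floor
    \<open>\<epsilon>\<close> suffices; the second serves \<open>t > 1\<close>, where
    \<open>1 + clamp_u\<close> is at least \<open>\<kappa>\<close>.\<close>
  define M where "M = 1 / \<epsilon> + 1 / \<kappa>\<^sup>2"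
  define e where "e t y = E_cut \<epsilon> t (fst y) (snd y)" for t y
  have M: "M > 0" using \<kappa> assms by (simp add: M_def add_pos_pos)
  have e: "e t y \<ge> \<epsilon>" for t y by (simp add: e_def E_cut_def)
  have tM: "\<bar>max t (- 1)\<bar> \<le> M * e t y" for t y
  proof (cases "t \<le> 1")
    case True
    then have "\<bar>max t (- 1)\<bar> \<le> 1" by auto
    also have "\<dots> \<le> 1 / \<epsilon> * e t y" using e[of t y] assms by (simp add: field_simps)
    also have "\<dots> \<le> M * e t y"
      using e[of t y] assms by (intro mult_right_mono) (auto simp: M_def)
    finally show ?thesis .
  next
    case False
    have "\<kappa>\<^sup>2 \<le> (1 + clamp_u (fst y))\<^sup>2"
      using \<kappa> clamp_u(1)[of "fst y"] by (intro power_mono) (auto simp: \<kappa>_def field_simps)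
    then have "t * \<kappa>\<^sup>2 \<le> t * (1 + clamp_u (fst y))\<^sup>2"
      using False by (intro mult_left_mono) auto
    also have "\<dots> \<le> e t y"
      using False by (simp add: e_def E_cut_def E_def le_max_iff_disj)
    finally have "t \<le> 1 / \<kappa>\<^sup>2 * e t y" using \<kappa> by (simp add: field_simps)
    also have "\<dots> \<le> M * e t y"
      using e[of t y] assms by (intro mult_right_mono) (auto simp: M_def)
    finally show ?thesis using False by simp
  qed
  have ediff: "\<bar>e t y - e t z\<bar> \<le> (M * L + \<alpha>\<^sup>2 * (exp 2 * 2) / \<epsilon>) * norm (y - z) * e t y" for t y z
  proof -
    have "\<bar>e t y - e t z\<bar> \<le> \<bar>max t (- 1) * ((1 + clamp_u (fst y))\<^sup>2 - (1 + clamp_u (fst z))\<^sup>2)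
        + \<alpha>\<^sup>2 * (exp (2 * min (snd y) 1) - exp (2 * min (snd z) 1))\<bar>"
      unfolding e_def E_cut_def E_def right_diff_distrib by linarith
    also have "\<dots> \<le> \<bar>max t (- 1)\<bar> * \<bar>(1 + clamp_u (fst y))\<^sup>2 - (1 + clamp_u (fst z))\<^sup>2\<bar>
        + \<alpha>\<^sup>2 * \<bar>exp (2 * min (snd y) 1) - exp (2 * min (snd z) 1)\<bar>"
      by (rule order_trans[OF abs_triangle_ineq]) (simp add: abs_mult)
    also have "\<dots> \<le> M * e t y * (L * norm (y - z)) + \<alpha>\<^sup>2 * (exp 2 * (2 * norm (y - z)))"
    proof (intro add_mono mult_mono tM q mult_left_mono)
      have "\<bar>exp (2 * min (snd y) 1) - exp (2 * min (snd z) 1)\<bar>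
          \<le> exp 2 * \<bar>2 * min (snd y) 1 - 2 * min (snd z) 1\<bar>"
        by (rule exp_diff_le) auto
      also have "\<dots> \<le> exp 2 * (2 * \<bar>snd y - snd z\<bar>)"
        by (intro mult_left_mono) (auto simp: min_def abs_if)
      also have "\<dots> \<le> exp 2 * (2 * norm (y - z))"
        using norm_snd_le[of "snd (y - z)" "fst (y - z)"] by (simp del: fst_diff snd_diff) (simp add: snd_diff)
      finally show "\<bar>exp (2 * min (snd y) 1) - exp (2 * min (snd z) 1)\<bar> \<le> exp 2 * (2 * norm (y - z))" .
    qed (use M e[of t y] assms in auto)
    \<comment> \<open>The exponential part has no factor \<open>e t y\<close> yet; it is inserted at
      the cost of \<open>1 / \<epsilon>\<close>, since
      \<open>e t y \<ge> \<epsilon>\<close>.\<close>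
    also have "\<alpha>\<^sup>2 * (exp 2 * (2 * norm (y - z))) \<le> \<alpha>\<^sup>2 * (exp 2 * (2 * norm (y - z))) * (e t y / \<epsilon>)"
      using e[of t y] assms mult_left_mono[of 1 "e t y / \<epsilon>" "\<alpha>\<^sup>2 * (exp 2 * (2 * norm (y - z)))"] by simp
    finally show ?thesis by (simp add: algebra_simps)
  qed
  show ?thesis
    unfolding bdd_lipschitz_def e_def[symmetric]
  proof (rule exI[of _ "1 / \<epsilon>"], rule exI[of _ "(M * L + \<alpha>\<^sup>2 * (exp 2 * 2) / \<epsilon>) / \<epsilon>"], intro allI conjI)
    fix t :: real and y z :: "real \<times> real"
    have pos: "e t y > 0" "e t z > 0" using e[of t y] e[of t z] assms by auto
    show "\<bar>inverse (e t y)\<bar> \<le> 1 / \<epsilon>"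
      using pos e[of t y] assms by (simp add: field_simps)
    have "\<bar>inverse (e t y) - inverse (e t z)\<bar> = \<bar>e t y - e t z\<bar> / e t y / e t z"
      using pos by (simp add: inverse_eq_divide diff_frac_eq abs_mult abs_minus_commute)
    also have "\<dots> \<le> (M * L + \<alpha>\<^sup>2 * (exp 2 * 2) / \<epsilon>) * norm (y - z) / e t z"
      using ediff[of t y z] pos by (intro divide_right_mono) (simp_all add: pos_divide_le_eq)
    also have "\<dots> \<le> (M * L + \<alpha>\<^sup>2 * (exp 2 * 2) / \<epsilon>) * norm (y - z) / \<epsilon>"
      using e[of t z] assms M L by (intro divide_left_mono) auto
    finally show "\<bar>inverse (e t y) - inverse (e t z)\<bar>
        \<le> (M * L + \<alpha>\<^sup>2 * (exp 2 * 2) / \<epsilon>) / \<epsilon> * norm (y - z)" by simp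
  qed
qed

text \<open>Integral form of the truncated system: the integrating factor \<open>t\<^bsup>d/2\<^esup>\<close> absorbs the singular
  term \<open>- d (u - u0)\<close>, and rescaling the integrals to \<open>[0,1]\<close> makes sense of it for \<open>t \<le> 0\<close> too.\<close>

definition solves_cut :: "real \<Rightarrow> (real \<Rightarrow> real) \<Rightarrow> (real \<Rightarrow> real) \<Rightarrow> bool" where
  "solves_cut \<epsilon> u l \<longleftrightarrow> continuous_on UNIV u \<and> continuous_on UNIV l \<and>
    (\<forall>t. u t = u0 + t / 2 * integral {0..1}
        (\<lambda>s. sqrt s ^ d * (P (clamp_u (u (t * s))) / E_cut \<epsilon> (t * s) (u (t * s)) (l (t * s))))) \<and>
    (\<forall>t. l t = t / 2 * integral {0..1}
        (\<lambda>s. N (clamp_u (u (t * s))) / E_cut \<epsilon> (t * s) (u (t * s)) (l (t * s))))"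

lemma E_cut_pos: "\<epsilon> > 0 \<Longrightarrow> E_cut \<epsilon> t x l > 0"
  by (simp add: E_cut_def less_max_iff_disj)

lemma continuous_on_P: "continuous_on X f \<Longrightarrow> continuous_on X (\<lambda>x. P (f x))"
  and continuous_on_N: "continuous_on X f \<Longrightarrow> continuous_on X (\<lambda>x. N (f x))"
  and continuous_on_clamp_u: "continuous_on X f \<Longrightarrow> continuous_on X (\<lambda>x. clamp_u (f x))"
  unfolding P_def N_def clamp_u_def by (intro continuous_intros; assumption)+

lemma continuous_on_E_cut:
  "continuous_on X f \<Longrightarrow> continuous_on X g \<Longrightarrow> continuous_on X h \<Longrightarrow>
    continuous_on X (\<lambda>x. E_cut \<epsilon> (f x) (g x) (h x))"
  unfolding E_cut_def E_def by (intro continuous_intros continuous_on_clamp_u; assumption)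

lemma ex_solves_cut:
  assumes "\<epsilon> > 0"
  shows "\<exists>u l. solves_cut \<epsilon> u l"
proof -
  define G where "G = (\<lambda>t y. P (clamp_u (fst y)) * inverse (E_cut \<epsilon> t (fst y) (snd y)))"
  define H where "H = (\<lambda>t y. N (clamp_u (fst y)) * inverse (E_cut \<epsilon> t (fst y) (snd y)))"
  have "bdd_lipschitz (\<lambda>t::real. \<lambda>y::real \<times> real.
     (1 + clamp_u (fst y)) * (1 + clamp_u (fst y)) * (real d * (clamp_u (fst y) + - u0))
     + (-1) * ((1 + clamp_u (fst y)) * clamp_u (fst y) * (r + clamp_u (fst y))))"
    by (intro bdd_lipschitz_mult bdd_lipschitz_add bdd_lipschitz_const bdd_lipschitz_clamp_u)
  then have "bdd_lipschitz (\<lambda>t::real. \<lambda>y::real \<times> real. P (clamp_u (fst y)))"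
    by (simp add: P_def power2_eq_square)
  then have bG: "bdd_lipschitz G"
    unfolding G_def by (intro bdd_lipschitz_mult bdd_lipschitz_inverse_E_cut assms)
  then obtain B1 L1 where G: "\<And>t y. \<bar>G t y\<bar> \<le> B1" "\<And>t y z. \<bar>G t y - G t z\<bar> \<le> L1 * norm (y - z)"
    using bdd_lipschitzE[OF bG] by metis
  have "bdd_lipschitz (\<lambda>t::real. \<lambda>y::real \<times> real.
     (1 + clamp_u (fst y)) * ((\<alpha> * real d) * (u0 + (-1) * clamp_u (fst y)))
     + \<alpha> * clamp_u (fst y) * (r + clamp_u (fst y)))"
    by (intro bdd_lipschitz_mult bdd_lipschitz_add bdd_lipschitz_const bdd_lipschitz_clamp_u)
  then have "bdd_lipschitz (\<lambda>t::real. \<lambda>y::real \<times> real. N (clamp_u (fst y)))"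
    by (simp add: N_def)
  then have bH: "bdd_lipschitz H"
    unfolding H_def by (intro bdd_lipschitz_mult bdd_lipschitz_inverse_E_cut assms)
  then obtain B2 L2 where H: "\<And>t y. \<bar>H t y\<bar> \<le> B2" "\<And>t y z. \<bar>H t y - H t z\<bar> \<le> L2 * norm (y - z)"
    using bdd_lipschitzE[OF bH] by metis
  \<comment> \<open>Both equations form one Volterra equation for the pair \<open>(u, l)\<close>;
    the weight \<open>sqrt s ^ d\<close> is at most 1 on \<open>{0..1}\<close> and spoils no
    bound.\<close>
  define F where "F s t y = (sqrt s ^ d * G t y, H t y)" for s t y
  have sqrt1: "\<bar>sqrt s ^ d * x\<bar> \<le> \<bar>x\<bar>" if "s \<in> {0..1}" for s x :: real
    using that power_le_one[of "sqrt s" d] mult_right_mono[of "sqrt s ^ d" 1 "\<bar>x\<bar>"]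
    by (simp add: abs_mult)
  have cG: "continuous_on X (\<lambda>x. G (f x) (g x))" "continuous_on X (\<lambda>x. H (f x) (g x))"
    if "continuous_on X f" "continuous_on X g" for X :: "'z::topological_space set" and f g
    unfolding G_def H_def
    by (intro continuous_on_mult continuous_on_inverse continuous_on_P continuous_on_N ballI
        continuous_on_clamp_u continuous_on_E_cut continuous_on_fst continuous_on_snd that
        E_cut_pos[OF assms, THEN less_imp_neq, THEN not_sym])+
  have "\<exists>y. continuous_on UNIV y \<and>
    (\<forall>t. y t = (u0, 0) + t *\<^sub>R integral {0..1} (\<lambda>s. (1/2) *\<^sub>R F s (t * s) (y (t * s))))"
  proof (rule scaled_volterra_solution)
    have "continuous_on ({0..1} \<times> UNIV) (\<lambda>p :: real \<times> real \<times> real \<times> real.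
        (1/2) *\<^sub>R (sqrt (fst p) ^ d * G (fst (snd p)) (snd (snd p)), H (fst (snd p)) (snd (snd p))))"
      by (intro continuous_on_scaleR continuous_on_const continuous_on_Pair continuous_on_mult
          continuous_on_power continuous_on_real_sqrt continuous_on_fst continuous_on_snd
          continuous_on_id cG)
    then show "continuous_on ({0..1} \<times> UNIV) (\<lambda>(s, t, y). (1/2) *\<^sub>R F s t y)"
      by (simp add: F_def split_beta)
    fix s :: real and t y z assume s: "s \<in> {0..1}"
    have "norm (F s t y) \<le> \<bar>sqrt s ^ d * G t y\<bar> + \<bar>H t y\<bar>"
      unfolding F_def using norm_Pair_le[of "sqrt s ^ d * G t y" "H t y"] by simp
    also have "\<dots> \<le> B1 + B2"
      using sqrt1[OF s, of "G t y"] G(1)[of t y] H(1)[of t y] by linarith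
    finally show "norm ((1/2) *\<^sub>R F s t y) \<le> B1 + B2"
      by (rule order_trans[rotated]) simp
    have "norm (F s t y - F s t z) \<le> \<bar>sqrt s ^ d * (G t y - G t z)\<bar> + \<bar>H t y - H t z\<bar>"
      unfolding F_def using norm_Pair_le[of "sqrt s ^ d * (G t y - G t z)" "H t y - H t z"]
      by (simp add: right_diff_distrib)
    also have "\<dots> \<le> L1 * norm (y - z) + L2 * norm (y - z)"
      using sqrt1[OF s, of "G t y - G t z"] G(2)[of t y z] H(2)[of t y z] by linarith
    finally show "norm ((1/2) *\<^sub>R F s t y - (1/2) *\<^sub>R F s t z) \<le> (L1 + L2) * norm (y - z)"
      unfolding distrib_right scaleR_diff_right[symmetric] by (rule order_trans[rotated]) simp
  qed
  then obtain y where y: "continuous_on UNIV y"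
    "\<And>t. y t = (u0, 0) + t *\<^sub>R integral {0..1} (\<lambda>s. (1/2) *\<^sub>R F s (t * s) (y (t * s)))"
    by blast
  have y2: "y t = (u0, 0) + (t / 2) *\<^sub>R integral {0..1} (\<lambda>s. F s (t * s) (y (t * s)))" for t
    using y(2)[of t] by (simp only: integral_cmul scaleR_scaleR mult_1_right times_divide_eq_right)
  have int: "(\<lambda>s. F s (t * s) (y (t * s))) integrable_on {0..1}" for t
    unfolding F_def
    by (intro integrable_continuous_real continuous_on_Pair continuous_on_mult
          continuous_on_power continuous_on_real_sqrt continuous_on_const
          continuous_on_id cG continuous_on_compose2[OF y(1)] subset_UNIV)
  have int_fst: "fst (integral {0..1} (\<lambda>s. F s (t * s) (y (t * s)))) =
      integral {0..1} (\<lambda>s. sqrt s ^ d * G (t * s) (y (t * s)))" for t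
    using integral_linear[OF int bounded_linear_fst] by (simp add: o_def F_def)
  have int_snd: "snd (integral {0..1} (\<lambda>s. F s (t * s) (y (t * s)))) =
      integral {0..1} (\<lambda>s. H (t * s) (y (t * s)))" for t
    using integral_linear[OF int bounded_linear_snd] by (simp add: o_def F_def)
  have u: "fst (y t) = u0 + t / 2 * integral {0..1} (\<lambda>s. sqrt s ^ d *
      (P (clamp_u (fst (y (t * s)))) / E_cut \<epsilon> (t * s) (fst (y (t * s))) (snd (y (t * s)))))" for t
  proof -
    have "fst (y t) = u0 + t / 2 * integral {0..1} (\<lambda>s. sqrt s ^ d * G (t * s) (y (t * s)))"
      using arg_cong[OF y2[of t], of fst] unfolding fst_add fst_scaleR int_fst by simp
    then show ?thesis
      unfolding G_def divide_inverse .
  qed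
  have l: "snd (y t) = t / 2 * integral {0..1} (\<lambda>s.
      N (clamp_u (fst (y (t * s)))) / E_cut \<epsilon> (t * s) (fst (y (t * s))) (snd (y (t * s))))" for t
  proof -
    have "snd (y t) = t / 2 * integral {0..1} (\<lambda>s. H (t * s) (y (t * s)))"
      using arg_cong[OF y2[of t], of snd] unfolding snd_add snd_scaleR int_snd by simp
    then show ?thesis
      unfolding H_def divide_inverse .
  qed
  have "solves_cut \<epsilon> (\<lambda>t. fst (y t)) (\<lambda>t. snd (y t))"
    unfolding solves_cut_def
    by (intro conjI allI continuous_on_fst[OF y(1)] continuous_on_snd[OF y(1)] u l)
  then show ?thesis by blast
qed

lemma solves_cut_has_derivative:
  assumes "\<epsilon> > 0" "solves_cut \<epsilon> u l"
  defines "G \<equiv> \<lambda>t. P (clamp_u (u t)) / E_cut \<epsilon> t (u t) (l t)"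
  defines "m \<equiv> \<lambda>t. integral {0..1} (\<lambda>s. sqrt s ^ d * G (t * s))"
  shows "(u has_real_derivative (G t - real d / 2 * m t) / 2) (at t)"
    and "u t = u0 + t / 2 * m t"
    and "(l has_real_derivative N (clamp_u (u t)) / E_cut \<epsilon> t (u t) (l t) / 2) (at t)"
    and "u 0 = u0" "l 0 = 0"
proof -
  note sol = assms(2)[unfolded solves_cut_def]
  note c = sol[THEN conjunct1] sol[THEN conjunct2, THEN conjunct1]
  define H where "H t = N (clamp_u (u t)) / E_cut \<epsilon> t (u t) (l t)" for t
  have u: "u x = u0 + x / 2 * m x" for x
    unfolding G_def m_def by (rule sol[THEN conjunct2, THEN conjunct2, THEN conjunct1, THEN spec])
  \<comment> \<open>Inserting the weight with exponent 0 lets the same derivative formula serve both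
    \<open>u\<close> and \<open>l\<close>.\<close>
  have l: "l x = x / 2 * integral {0..1} (\<lambda>s. sqrt s ^ 0 * H (x * s))" for x
    unfolding H_def power_0 mult_1 by (rule sol[THEN conjunct2, THEN conjunct2, THEN conjunct2, THEN spec])
  show "u t = u0 + t / 2 * m t" by (rule u)
  show "u 0 = u0" using u[of 0] by simp
  show "l 0 = 0" using l[of 0] by simp
  have c_inv: "continuous_on UNIV (\<lambda>t. inverse (E_cut \<epsilon> t (u t) (l t)))"
    using E_cut_pos[OF assms(1), THEN less_imp_neq, THEN not_sym]
    by (intro continuous_on_inverse continuous_on_E_cut[OF continuous_on_id c]) blast
  have "continuous_on UNIV G"
    unfolding G_def divide_inverse
    by (rule continuous_on_mult[OF continuous_on_P[OF continuous_on_clamp_u[OF c(1)]] c_inv])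
  moreover have "continuous_on UNIV H"
    unfolding H_def divide_inverse
    by (rule continuous_on_mult[OF continuous_on_N[OF continuous_on_clamp_u[OF c(1)]] c_inv])
  ultimately have cGH: "continuous_on UNIV G" "continuous_on UNIV H" .
  note D = cGH[THEN scaled_integral_power_has_derivative]
  have Du: "((\<lambda>t. u0 + t * m t / 2) has_real_derivative (G t - real d / 2 * m t) / 2) (at t)"
    using DERIV_add[OF DERIV_const[of u0] DERIV_cdivide[OF D(1)[of d t], of 2]]
    unfolding m_def by simp
  show "(u has_real_derivative (G t - real d / 2 * m t) / 2) (at t)"
    by (rule has_field_derivative_transform_within_open[OF Du open_UNIV UNIV_I]) (simp add: u)
  have Dl: "((\<lambda>t. t * integral {0..1} (\<lambda>s. sqrt s ^ 0 * H (t * s)) / 2) has_real_derivative H t / 2) (at t)"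
    using DERIV_cdivide[OF D(2)[of 0 t], of 2] by simp
  have "(l has_real_derivative H t / 2) (at t)"
    by (rule has_field_derivative_transform_within_open[OF Dl open_UNIV UNIV_I]) (simp add: l)
  then show "(l has_real_derivative N (clamp_u (u t)) / E_cut \<epsilon> t (u t) (l t) / 2) (at t)"
    by (simp only: H_def)
qed

section \<open>A priori bounds for nonnegative t\<close>

lemma E_cut_ge:
  assumes "t \<ge> 0"
  shows "t * (1 + clamp_u x)\<^sup>2 \<le> E_cut \<epsilon> t x l" "\<alpha>\<^sup>2 * exp (2 * min l 1) \<le> E_cut \<epsilon> t x l"
  using assms by (auto simp: E_cut_def E_def le_max_iff_disj)

text \<open>Where \<open>u \<ge> 0\<close>, the term \<open>(1 + u) u (r + u)\<close> in
  \<open>P\<close> pushes down and \<open>t (1 + u)\<^sup>2 \<le> E_cut\<close> makes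
  \<open>- d (u - u0)\<close> outweigh the rest, so 0 is an upper barrier; at or below
  \<open>u0\<close> all signs reverse. Inside the strip \<open>N < 0\<close>, so \<open>l\<close>
  decreases from 0.\<close>

lemma solves_cut_bounds:
  assumes \<epsilon>: "\<epsilon> > 0" and sol: "solves_cut \<epsilon> u l" and "t \<ge> 0"
  shows "u t \<le> 0" "u0 \<le> u t" "l t \<le> 0"
proof -
  define G where "G t = P (clamp_u (u t)) / E_cut \<epsilon> t (u t) (l t)" for t
  define u' where "u' t = (G t - real d / 2 * integral {0..1} (\<lambda>s. sqrt s ^ d * G (t * s))) / 2" for t
  have Du: "(u has_real_derivative u' t) (at t)" for t
    using solves_cut_has_derivative(1)[OF \<epsilon> sol, of t] unfolding u'_def G_def .
  have u: "u t = u0 + t / 2 * integral {0..1} (\<lambda>s. sqrt s ^ d * G (t * s))" for t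
    using solves_cut_has_derivative(2)[OF \<epsilon> sol, of t] unfolding G_def .
  \<comment> \<open>The integral formula for \<open>u\<close> eliminates the average and recovers
    the singular differential equation.\<close>
  have u': "2 * t * u' t = t * G t - real d * (u t - u0)" for t
  proof -
    let ?m = "integral {0..1} (\<lambda>s. sqrt s ^ d * G (t * s))"
    have "t * ?m = 2 * (u t - u0)" using u[of t] by simp
    moreover have "2 * t * u' t = t * G t - real d / 2 * (t * ?m)"
      by (simp only: u'_def) (simp add: field_simps)
    ultimately show ?thesis by simp
  qed
  define c where "c t = clamp_u (u t)" for t
  have Epos: "E_cut \<epsilon> t x y > 0" for t x y using E_cut_pos[OF \<epsilon>] .
  have c: "0 < 1 + c t" for t unfolding c_def by (rule clamp_u)
  have rc: "0 < r + c t" for t using c[of t] r by linarith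
  have up: "u' t \<le> 0" if "t > 0" "u t \<ge> 0" for t
  proof -
    \<comment> \<open>The clamped value lies between the barrier 0 and \<open>u t\<close>, so the
      estimate also covers points where the clamp is active.\<close>
    have c0: "0 \<le> c t" "c t \<le> u t" using that u0 by (auto simp: c_def clamp_u_def)
    have "P (c t) \<le> (1 + c t)\<^sup>2 * (real d * (c t - u0))"
      using c[of t] c0 rc[of t] by (simp add: P_def)
    then have "t * P (c t) \<le> (t * (1 + c t)\<^sup>2) * (real d * (c t - u0))"
      using mult_left_mono[of _ _ t] that by (simp add: mult.assoc)
    also have "\<dots> \<le> E_cut \<epsilon> t (u t) (l t) * (real d * (c t - u0))"
      unfolding c_def using E_cut_ge(1)[of t] that c0 u0 d by (intro mult_right_mono) (auto simp: c_def)
    finally have "t * G t \<le> real d * (c t - u0)"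
      using Epos[of t "u t" "l t"] by (simp add: G_def c_def pos_divide_le_eq mult.commute)
    also have "\<dots> \<le> real d * (u t - u0)"
      using c0 by (intro mult_left_mono) auto
    finally have "t * (2 * u' t) \<le> 0" using u'[of t] by (simp add: mult_ac)
    then show ?thesis using that by (simp add: mult_le_0_iff)
  qed
  show "u t \<le> 0"
    using bounded_above_by_barrier[OF Du _ up \<open>t \<ge> 0\<close>] u[of 0] u0 by simp
  have lo: "- u' t \<le> 0" if "t > 0" "- u t \<ge> - u0" for t
  proof -
    have c0: "c t \<le> u0" "u t \<le> c t" using that u0 by (auto simp: c_def clamp_u_def)
    have "(1 + c t) * c t * (r + c t) \<le> 0"
      using c[of t] c0 rc[of t] u0 by (intro mult_nonpos_nonneg mult_nonneg_nonpos) auto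
    then have "(1 + c t)\<^sup>2 * (real d * (c t - u0)) \<le> P (c t)"
      by (simp add: P_def)
    then have "(t * (1 + c t)\<^sup>2) * (real d * (c t - u0)) \<le> t * P (c t)"
      using mult_left_mono[of _ _ t] that by (simp add: mult.assoc)
    moreover have "E_cut \<epsilon> t (u t) (l t) * (real d * (c t - u0)) \<le> (t * (1 + c t)\<^sup>2) * (real d * (c t - u0))"
      using E_cut_ge(1)[of t] that c0 d by (intro mult_right_mono_neg) (auto simp: c_def mult_nonneg_nonpos)
    ultimately have "real d * (c t - u0) \<le> t * G t"
      using Epos[of t "u t" "l t"] by (simp add: G_def c_def pos_le_divide_eq mult.commute)
    moreover have "real d * (u t - u0) \<le> real d * (c t - u0)"
      using c0 by (intro mult_left_mono) auto
    ultimately have "t * (2 * u' t) \<ge> 0" using u'[of t] by (simp add: mult_ac)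
    then show ?thesis using that by (simp add: zero_le_mult_iff)
  qed
  have u_ge: "u0 \<le> u t" if "t \<ge> 0" for t
    using bounded_above_by_barrier[where c = "- u0", OF DERIV_minus[OF Du] _ lo that] u[of 0] by simp
  then show "u0 \<le> u t" using \<open>t \<ge> 0\<close> .
  have u_le: "u t \<le> 0" if "t \<ge> 0" for t
    using bounded_above_by_barrier[OF Du _ up that] u[of 0] u0 by simp
  have "N (clamp_u (u t)) / E_cut \<epsilon> t (u t) (l t) / 2 \<le> 0" if "t > 0" for t
  proof -
    have "clamp_u (u t) = u t" using u_ge[of t] u_le[of t] that u0 by (simp add: clamp_u_def)
    then show ?thesis
      using N_neg[of "u t"] u_ge[of t] u_le[of t] that Epos[of t "u t" "l t"]
      by (simp add: divide_nonpos_pos)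
  qed
  then show "l t \<le> 0"
    using bounded_above_by_barrier[OF solves_cut_has_derivative(3)[OF \<epsilon> sol] _ _ \<open>t \<ge> 0\<close>, of 0]
      solves_cut_has_derivative(5)[OF \<epsilon> sol] by simp
qed

lemma N_lower_bound:
  assumes "u0 \<le> x" "x \<le> 0"
  shows "- (\<alpha> * real d + \<alpha> * r) \<le> N x"
proof -
  have "(1 + x) * (\<alpha> * real d * (x - u0)) \<le> 1 * (\<alpha> * real d * 1)"
    using assms u0 \<alpha> d by (intro mult_mono) auto
  moreover have "\<alpha> * (- x) * (r + x) \<le> \<alpha> * 1 * r"
    using assms u0 \<alpha> r by (intro mult_mono) auto
  ultimately show ?thesis by (simp add: N_def algebra_simps)
qed

text \<open>The bound is uniform in the cut-off level, so for a small enough level the cut-off of \<open>E\<close>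
  is inactive for all \<open>t \<ge> 0\<close>.\<close>

lemma solves_cut_E_ge:
  assumes \<epsilon>: "\<epsilon> > 0" and sol: "solves_cut \<epsilon> u l" and "t \<ge> 0"
  defines "C \<equiv> \<alpha> * real d + \<alpha> * r"
  shows "min (\<alpha>\<^sup>2 / 2) (\<alpha>\<^sup>2 / (2 * C) * (1 + u0)\<^sup>2) \<le> E t (u t) (l t)"
proof -
  note bounds = solves_cut_bounds[OF \<epsilon> sol]
  have C: "C > 0" using \<alpha> d r by (simp add: C_def add_pos_pos)
  have E1: "\<alpha>\<^sup>2 * exp (2 * l t) \<le> E t (u t) (l t)" "t * (1 + u t)\<^sup>2 \<le> E t (u t) (l t)" if "t \<ge> 0" for t
    using that by (auto simp: E_def)
  define h where "h t = N (clamp_u (u t)) / E_cut \<epsilon> t (u t) (l t) / 2" for t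
  \<comment> \<open>Since \<open>E_cut \<ge> \<alpha>\<^sup>2 exp (2 l)\<close>, the derivative of
    \<open>exp (2 l)\<close> is at least \<open>- C / \<alpha>\<^sup>2\<close> whatever
    \<open>\<epsilon>\<close> is. The barrier lemma thus gives
    \<open>exp (2 l) \<ge> 1 - C t / \<alpha>\<^sup>2\<close>.\<close>
  have D: "((\<lambda>t. - exp (2 * l t) - C / \<alpha>\<^sup>2 * t) has_real_derivative
      - (exp (2 * l t) * (2 * h t)) - C / \<alpha>\<^sup>2) (at t)" for t
    by (rule DERIV_diff[OF DERIV_minus[OF DERIV_fun_exp[OF DERIV_cmult[
              OF solves_cut_has_derivative(3)[OF \<epsilon> sol, of t, folded h_def]]]] DERIV_cmult_Id])
  have "- (exp (2 * l t) * (2 * h t)) - C / \<alpha>\<^sup>2 \<le> 0" if "t > 0" for t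
  proof -
    have cl: "clamp_u (u t) = u t" using bounds[of t] that u0 by (simp add: clamp_u_def)
    have "- N (u t) \<le> C"
      using N_lower_bound[of "u t"] bounds[of t] that by (simp add: C_def)
    then have "exp (2 * l t) * (- N (u t)) \<le> exp (2 * l t) * C" by (intro mult_left_mono) auto
    also have "\<dots> \<le> E_cut \<epsilon> t (u t) (l t) / \<alpha>\<^sup>2 * C"
      using E_cut_ge(2)[of t "l t" \<epsilon> "u t"] bounds(3)[of t] that C \<alpha>
      by (intro mult_right_mono) (auto simp: field_simps)
    finally show ?thesis
      using E_cut_pos[OF \<epsilon>, of t "u t" "l t"] \<alpha> unfolding h_def cl by (simp add: field_simps)
  qed
  then have "- exp (2 * l t) - C / \<alpha>\<^sup>2 * t \<le> - 1"
    using bounded_above_by_barrier[OF D _ _ \<open>t \<ge> 0\<close>, of "- 1"]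
      solves_cut_has_derivative(5)[OF \<epsilon> sol] by simp
  then have ex: "1 - C / \<alpha>\<^sup>2 * t \<le> exp (2 * l t)" by simp
  show ?thesis
  \<comment> \<open>Up to this time the linear bound keeps \<open>exp (2 l)\<close> at least 1/2;
    afterwards \<open>t (1 + u)\<^sup>2\<close> alone is large enough.\<close>
  proof (cases "t \<le> \<alpha>\<^sup>2 / (2 * C)")
    case True
    then have "C / \<alpha>\<^sup>2 * t \<le> 1 / 2" using C \<alpha> by (simp add: field_simps)
    then have "1 / 2 \<le> exp (2 * l t)" using ex by linarith
    then have "\<alpha>\<^sup>2 * (1 / 2) \<le> \<alpha>\<^sup>2 * exp (2 * l t)" by (intro mult_left_mono) auto
    then show ?thesis using E1(1)[OF \<open>t \<ge> 0\<close>] by linarith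
  next
    case False
    have "(1 + u0)\<^sup>2 \<le> (1 + u t)\<^sup>2"
      using bounds(2)[OF \<open>t \<ge> 0\<close>] u0 by (intro power_mono) auto
    then have "\<alpha>\<^sup>2 / (2 * C) * (1 + u0)\<^sup>2 \<le> t * (1 + u t)\<^sup>2"
      using False \<open>t \<ge> 0\<close> by (intro mult_mono) auto
    then show ?thesis using E1(2)[OF \<open>t \<ge> 0\<close>] by linarith
  qed
qed

section \<open>Removal of the truncation and smoothness across t = 0\<close>

lemma Ck_on_E:
  assumes "open X" "Ck_on k X u" "Ck_on k X l"
  shows "Ck_on k X (\<lambda>t. E t (u t) (l t))"
proof -
  have 1: "Ck_on k X (\<lambda>t. 1 + u t)"
    using assms(1) Ck_on_const assms(2) by (rule Ck_on_add)
  have 2: "Ck_on k X (\<lambda>t. t * ((1 + u t) * (1 + u t)))"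
    by (intro Ck_on_mult[OF assms(1)] 1 Ck_on_linear[OF assms(1) bounded_linear_ident])
  have "Ck_on k X (\<lambda>t. exp (2 * l t))"
    by (rule Ck_on_compose_real[OF assms(1) subset_UNIV Ck_on_exp
          Ck_on_mult[OF assms(1) Ck_on_const assms(3)]])
  from Ck_on_add[OF assms(1) 2 Ck_on_mult[OF assms(1) Ck_on_const[of _ _ "\<alpha>\<^sup>2"] this]]
  show ?thesis
    by (simp only: E_def power2_eq_square[of "1 + u t" for t])
qed

lemma Ck_on_P_N:
  assumes "open X" "Ck_on k X u"
  shows "Ck_on k X (\<lambda>t. P (u t))" "Ck_on k X (\<lambda>t. N (u t))"
proof -
  note mult = Ck_on_mult[OF assms(1)] and add = Ck_on_add[OF assms(1)]
  have 1: "Ck_on k X (\<lambda>t. c + u t)" for c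
    by (rule add[OF Ck_on_const assms(2)])
  have "Ck_on k X (\<lambda>t. ((1 + u t) * (1 + u t)) * (real d * (- u0 + u t)) + -1 * ((1 + u t) * u t * (r + u t)))"
    by (rule add[OF mult[OF mult[OF 1 1] mult[OF Ck_on_const 1]]
          mult[OF Ck_on_const mult[OF mult[OF 1 assms(2)] 1]]])
  then show "Ck_on k X (\<lambda>t. P (u t))"
    by (simp add: P_def power2_eq_square)
  have "Ck_on k X (\<lambda>t. (1 + u t) * (- (\<alpha> * real d) * (- u0 + u t)) + \<alpha> * u t * (r + u t))"
    by (rule add[OF mult[OF 1 mult[OF Ck_on_const 1]] mult[OF mult[OF Ck_on_const assms(2)] 1]])
  then show "Ck_on k X (\<lambda>t. N (u t))"
    by (simp add: N_def algebra_simps)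
qed

lemma ex_smooth_solution:
  "\<exists>\<delta> > 0. \<exists>u l u' l' :: real \<Rightarrow> real.
     smooth_on {- \<delta><..} u \<and> smooth_on {- \<delta><..} l \<and> u 0 = u0 \<and> l 0 = 0 \<and>
     (\<forall>t \<ge> 0. u0 \<le> u t \<and> u t \<le> 0 \<and> l t \<le> 0 \<and>
        (u has_real_derivative u' t) (at t) \<and> (l has_real_derivative l' t) (at t) \<and>
        2 * t * u' t * E t (u t) (l t) =
          \<alpha>\<^sup>2 * exp (2 * l t) * (real d * (u0 - u t)) - t * (1 + u t) * u t * (r + u t) \<and>
        2 * l' t * E t (u t) (l t) = N (u t))"
proof -
  define C where "C = \<alpha> * real d + \<alpha> * r"
  have C: "C > 0" using \<alpha> d r by (simp add: C_def add_pos_pos)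
  \<comment> \<open>Half of the uniform lower bound, so that \<open>E > \<epsilon>\<close> holds
    strictly and persists slightly to the left of 0.\<close>
  define \<epsilon> where "\<epsilon> = min (\<alpha>\<^sup>2 / 2) (\<alpha>\<^sup>2 / (2 * C) * (1 + u0)\<^sup>2) / 2"
  have \<epsilon>: "\<epsilon> > 0" using C \<alpha> u0 by (simp add: \<epsilon>_def)
  obtain u l where sol: "solves_cut \<epsilon> u l" using ex_solves_cut[OF \<epsilon>] by blast
  note bounds = solves_cut_bounds[OF \<epsilon> sol]
  have cont: "continuous_on UNIV u" "continuous_on UNIV l"
    using sol[unfolded solves_cut_def, THEN conjunct1]
      sol[unfolded solves_cut_def, THEN conjunct2, THEN conjunct1] .
  note init = solves_cut_has_derivative(4,5)[OF \<epsilon> sol]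
  have E_gt: "\<epsilon> < E t (u t) (l t)" if "t \<ge> 0" for t
    using solves_cut_E_ge[OF \<epsilon> sol that, folded C_def] \<epsilon> unfolding \<epsilon>_def by linarith
  \<comment> \<open>On this open set no truncation is active. It contains all
    \<open>t \<ge> 0\<close>, so one ball around 0 extends it to a half-line beginning at a negative
    number.\<close>
  define W where "W = {t. (u0 - 1) / 2 < u t} \<inter> {t. u t < 1} \<inter> {t. l t < 1} \<inter>
      {t. \<epsilon> < E t (u t) (l t)} \<inter> {t. - 1 < t}"
  have "continuous_on UNIV (\<lambda>t. E t (u t) (l t))"
    unfolding E_def by (intro continuous_intros cont)
  then have "open W"
    unfolding W_def by (intro open_Int open_Collect_less continuous_on_const cont continuous_on_id)
  have W0: "t \<in> W" if "t \<ge> 0" for t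
    using bounds[OF that] E_gt[OF that] that u0 by (simp add: W_def)
  obtain \<delta> where \<delta>: "\<delta> > 0" "ball 0 \<delta> \<subseteq> W"
    using \<open>open W\<close> W0[of 0] open_contains_ball by blast
  define X where "X = {- \<delta><..}"
  have XW: "X \<subseteq> W"
  proof
    fix t assume "t \<in> X"
    then show "t \<in> W" using W0[of t] \<delta>(2) by (cases "t \<ge> 0") (auto simp: X_def)
  qed
  have uncut: "clamp_u (u t) = u t" "E_cut \<epsilon> t (u t) (l t) = E t (u t) (l t)" if "t \<in> X" for t
  proof -
    have "t \<in> W" using that XW by blast
    then show *: "clamp_u (u t) = u t" by (simp add: W_def clamp_u_def)
    show "E_cut \<epsilon> t (u t) (l t) = E t (u t) (l t)"
      using \<open>t \<in> W\<close> unfolding E_cut_def * by (simp add: W_def)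
  qed
  have Epos: "E t (u t) (l t) > 0" if "t \<in> X" for t
    using that XW \<epsilon> by (auto simp: W_def)
  have X: "open X" "convex X" "0 \<in> X"
    using \<delta> by (auto simp: X_def)
  define G where "G t = P (clamp_u (u t)) / E_cut \<epsilon> t (u t) (l t)" for t
  define m where "m t = integral {0..1} (\<lambda>s. sqrt s ^ d * G (t * s))" for t
  define u' where "u' t = (G t - real d / 2 * m t) / 2" for t
  define l' where "l' t = N (clamp_u (u t)) / E_cut \<epsilon> t (u t) (l t) / 2" for t
  have Du: "(u has_real_derivative u' t) (at t)" for t
    using solves_cut_has_derivative(1)[OF \<epsilon> sol, of t] unfolding u'_def m_def G_def .
  have u: "u t = u0 + t / 2 * m t" for t
    using solves_cut_has_derivative(2)[OF \<epsilon> sol, of t] unfolding m_def G_def .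
  have Dl: "(l has_real_derivative l' t) (at t)" for t
    using solves_cut_has_derivative(3)[OF \<epsilon> sol, of t] unfolding l'_def .
  \<comment> \<open>Bootstrapping: if \<open>u\<close> and \<open>l\<close> are C^k, so are
    \<open>G\<close>, its weighted average \<open>m\<close>, and hence the derivatives
    \<open>u'\<close> and \<open>l'\<close>.\<close>
  have "Ck_on k X u \<and> Ck_on k X l" for k
  proof (induction k)
    case 0
    show ?case
      unfolding Ck_on.simps(1)
      by (intro conjI cont[THEN continuous_on_subset] subset_UNIV)
  next
    case (Suc k)
    then have ck: "Ck_on k X u" "Ck_on k X l" by auto
    have inv: "Ck_on k X (\<lambda>t. inverse (E t (u t) (l t)))"
      by (rule Ck_on_compose_real[OF X(1) _ Ck_on_inverse Ck_on_E[OF X(1) ck]]) (auto intro: Epos)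
    have "Ck_on k X G"
      by (rule Ck_on_cong[OF X(1) _ Ck_on_mult[OF X(1) Ck_on_P_N(1)[OF X(1) ck(1)] inv]])
        (simp add: G_def uncut divide_inverse)
    then have "Ck_on k X m"
      unfolding m_def by (intro Ck_on_scaled_integral X continuous_intros)
    have "Ck_on k X (\<lambda>t. (1/2) * (G t + (- real d / 2) * m t))"
      by (intro Ck_on_mult[OF X(1)] Ck_on_add[OF X(1)] Ck_on_const \<open>Ck_on k X G\<close> \<open>Ck_on k X m\<close>)
    then have ck_u': "Ck_on k X u'"
      by (rule Ck_on_cong[OF X(1), rotated]) (simp add: u'_def)
    have "Ck_on k X (\<lambda>t. (1/2) * (N (u t) * inverse (E t (u t) (l t))))"
      by (intro Ck_on_mult[OF X(1)] Ck_on_const Ck_on_P_N(2)[OF X(1) ck(1)] inv)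
    then have ck_l': "Ck_on k X l'"
      by (rule Ck_on_cong[OF X(1), rotated]) (simp add: l'_def uncut inverse_eq_divide)
    show ?case
      by (rule conjI[OF Ck_on_has_real_derivative[OF X(1) Du ck_u']
            Ck_on_has_real_derivative[OF X(1) Dl ck_l']])
  qed
  then have smooth: "smooth_on {- \<delta><..} u" "smooth_on {- \<delta><..} l"
    by (simp_all add: smooth_on_def X_def)
  have eqs: "2 * t * u' t * E t (u t) (l t) =
          \<alpha>\<^sup>2 * exp (2 * l t) * (real d * (u0 - u t)) - t * (1 + u t) * u t * (r + u t) \<and>
        2 * l' t * E t (u t) (l t) = N (u t)" if "t \<ge> 0" for t
  proof -
    have t: "t \<in> X" using that \<delta> by (simp add: X_def)
    define e where "e = E t (u t) (l t)"
    have e: "e > 0" using Epos[OF t] by (simp add: e_def)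
    have G: "G t = P (u t) / e" by (simp add: G_def uncut t e_def)
    have "2 * t * u' t = t * G t - real d * (u t - u0)"
    proof -
      have "t * m t = 2 * (u t - u0)" using u[of t] by simp
      moreover have "2 * t * u' t = t * G t - real d / 2 * (t * m t)"
        by (simp add: u'_def field_simps)
      ultimately show ?thesis by simp
    qed
    then have "2 * t * u' t * e = t * P (u t) - real d * (u t - u0) * e"
      using e by (simp add: G left_diff_distrib)
    \<comment> \<open>The part \<open>t (1 + u)\<^sup>2 d (u - u0)\<close> of \<open>t P\<close>
      cancels against the same part of \<open>d (u - u0) E\<close>, which leaves only the
      exponential part of \<open>E\<close>.\<close>
    also have "\<dots> = \<alpha>\<^sup>2 * exp (2 * l t) * (real d * (u0 - u t)) - t * (1 + u t) * u t * (r + u t)"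
      by (simp add: e_def E_def P_def algebra_simps)
    finally show ?thesis
      using e by (simp add: l'_def uncut t flip: e_def)
  qed
  show ?thesis
    by (rule exI[of _ \<delta>], rule conjI[OF \<delta>(1)],
        rule exI[of _ u], rule exI[of _ l], rule exI[of _ u'], rule exI[of _ l'])
      (intro conjI allI impI smooth init bounds Du Dl conjunct1[OF eqs] conjunct2[OF eqs])
qed

section \<open>Decay at infinity and the profile equations\<close>

lemma N_upper_bound: "\<exists>c > 0. \<forall>x. u0 \<le> x \<longrightarrow> x \<le> 0 \<longrightarrow> N x \<le> - c"
proof -
  have "continuous_on {u0..0} N"
    using continuous_on_N[OF continuous_on_id] by simp
  then obtain x where x: "x \<in> {u0..0}" "\<And>y. y \<in> {u0..0} \<Longrightarrow> N y \<le> N x"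
    using continuous_attains_sup[of "{u0..0}" N] u0 by auto
  then show ?thesis
    using N_neg[of x] by (intro exI[of _ "- N x"]) auto
qed

text \<open>The last two equations are the profile equations divided by \<open>\<zeta>\<close> and
  by \<open>S\<close> respectively, so that they remain meaningful at \<open>t = 0\<close>.\<close>

lemma ex_profile:
  "\<exists>\<delta> > 0. \<exists>u l u' l' :: real \<Rightarrow> real.
     smooth_on {- \<delta><..} u \<and> smooth_on {- \<delta><..} l \<and> u 0 = u0 \<and> l 0 = 0 \<and>
     ((\<lambda>x. x * u (x\<^sup>2)) \<longlongrightarrow> 0) at_top \<and> ((\<lambda>x. exp (l (x\<^sup>2))) \<longlongrightarrow> 0) at_top \<and>
     (\<forall>x. ((\<lambda>x. x * u (x\<^sup>2)) has_real_derivative u (x\<^sup>2) + 2 * x\<^sup>2 * u' (x\<^sup>2)) (at x) \<and>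
          ((\<lambda>x. exp (l (x\<^sup>2))) has_real_derivative exp (l (x\<^sup>2)) * (2 * l' (x\<^sup>2)) * x) (at x)) \<and>
     (\<forall>t \<ge> 0. - (r - 1) * u t - (1 + u t) * (u t + 2 * t * u' t) + \<alpha> * exp (2 * l t) * (2 * l' t) = 0 \<and>
        - (r - 1) - (1 + u t) * t * (2 * l' t) - \<alpha> * (u t + 2 * t * u' t) - \<alpha> * (real d - 1) * u t = 0)"
proof -
  obtain \<delta> u l u' l' where \<delta>: "\<delta> > 0" and smooth: "smooth_on {- \<delta><..} u" "smooth_on {- \<delta><..} l"
    and init: "u 0 = u0" "l 0 = 0"
    and sol: "\<forall>t \<ge> 0. u0 \<le> u t \<and> u t \<le> 0 \<and> l t \<le> 0 \<and>
        (u has_real_derivative u' t) (at t) \<and> (l has_real_derivative l' t) (at t) \<and>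
        2 * t * u' t * E t (u t) (l t) =
          \<alpha>\<^sup>2 * exp (2 * l t) * (real d * (u0 - u t)) - t * (1 + u t) * u t * (r + u t) \<and>
        2 * l' t * E t (u t) (l t) = N (u t)"
    using ex_smooth_solution by (elim exE conjE) (rule that; assumption)
  note sol = sol[THEN spec, THEN mp]
  note bounds = sol[THEN conjunct1] sol[THEN conjunct2, THEN conjunct1]
    sol[THEN conjunct2, THEN conjunct2, THEN conjunct1]
  note sol = sol[THEN conjunct2, THEN conjunct2, THEN conjunct2]
  note Du = sol[THEN conjunct1] and Dl = sol[THEN conjunct2, THEN conjunct1]
  note u' = sol[THEN conjunct2, THEN conjunct2, THEN conjunct1]
    and l' = sol[THEN conjunct2, THEN conjunct2, THEN conjunct2]
  have Epos: "E t (u t) (l t) > 0" if "t \<ge> 0" for t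
    using that \<alpha> by (auto simp: E_def intro!: add_nonneg_pos)
  have E_le: "E t (u t) (l t) \<le> (1 + \<alpha>\<^sup>2) * t" if "t \<ge> 1" for t
  proof -
    have "(1 + u t)\<^sup>2 \<le> 1"
      using bounds[of t] u0 that by (simp add: power_le_one)
    then have "t * (1 + u t)\<^sup>2 \<le> t * 1" using that by (intro mult_left_mono) auto
    moreover have "\<alpha>\<^sup>2 * exp (2 * l t) \<le> \<alpha>\<^sup>2 * t"
      using bounds(3)[of t] that by (intro mult_left_mono order_trans[of "exp (2 * l t)" 1 t]) auto
    ultimately show ?thesis by (simp add: E_def algebra_simps)
  qed
  have E_ge: "(1 + u0)\<^sup>2 * t \<le> E t (u t) (l t)" if "t \<ge> 0" for t
  proof -
    have "(1 + u0)\<^sup>2 \<le> (1 + u t)\<^sup>2"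
      using bounds(1)[OF that] u0 by (intro power_mono) auto
    then have "t * (1 + u0)\<^sup>2 \<le> t * (1 + u t)\<^sup>2" using that by (intro mult_left_mono)
    then show ?thesis by (simp add: E_def mult.commute add_increasing2)
  qed
  have DU: "((\<lambda>x. x * u (x\<^sup>2)) has_real_derivative u (x\<^sup>2) + 2 * x\<^sup>2 * u' (x\<^sup>2)) (at x)" for x
  proof -
    have "((\<lambda>x. u (x\<^sup>2)) has_real_derivative u' (x\<^sup>2) * (2 * x)) (at x)"
      using DERIV_chain2[OF Du[of "x\<^sup>2"] DERIV_power[OF DERIV_ident, of 2]] by simp
    from DERIV_mult[OF DERIV_ident this] show ?thesis
      by (simp add: power2_eq_square algebra_simps)
  qed
  have DS: "((\<lambda>x. exp (l (x\<^sup>2))) has_real_derivative exp (l (x\<^sup>2)) * (2 * l' (x\<^sup>2)) * x) (at x)" for x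
  proof -
    have "((\<lambda>x. l (x\<^sup>2)) has_real_derivative l' (x\<^sup>2) * (2 * x)) (at x)"
      using DERIV_chain2[OF Dl[of "x\<^sup>2"] DERIV_power[OF DERIV_ident, of 2]] by simp
    from DERIV_fun_exp[OF this] show ?thesis
      by (simp add: mult_ac)
  qed
  have lim_S: "((\<lambda>x. exp (l (x\<^sup>2))) \<longlongrightarrow> 0) at_top"
  proof -
    obtain c where c: "c > 0" "\<And>x. u0 \<le> x \<Longrightarrow> x \<le> 0 \<Longrightarrow> N x \<le> - c"
      using N_upper_bound by blast
    show ?thesis
    proof (rule tendsto_zero_of_euler_inequality[OF DS])
      fix x :: real assume x: "x \<ge> 1"
      define t where "t = x\<^sup>2"
      have t: "t \<ge> 1" using x by (simp add: t_def)
      have "2 * t * l' t * E t (u t) (l t) = t * N (u t)"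
        using l'[of t] t by (simp add: algebra_simps)
      also have "\<dots> \<le> t * (- c)"
        using c(2) bounds t by (intro mult_left_mono) auto
      also have "\<dots> \<le> - (c / (1 + \<alpha>\<^sup>2)) * E t (u t) (l t)"
      proof -
        have q: "1 + \<alpha>\<^sup>2 > 0" by (simp add: add_pos_nonneg)
        then have "c / (1 + \<alpha>\<^sup>2) * E t (u t) (l t) \<le> c / (1 + \<alpha>\<^sup>2) * ((1 + \<alpha>\<^sup>2) * t)"
          using c(1) by (intro mult_left_mono E_le t) auto
        also have "\<dots> = t * c" using q by simp
        finally show ?thesis by simp
      qed
      \<comment> \<open>For \<open>t \<ge> 1\<close>, \<open>E\<close> is at most a multiple of
        \<open>t\<close> and \<open>N\<close> stays below a negative constant; so the logarithmic
        derivative \<open>\<zeta> S' / S = 2 t l'\<close> is bounded away from 0 and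
        \<open>S\<close> decays like a power.\<close>
      finally have "2 * t * l' t \<le> - (c / (1 + \<alpha>\<^sup>2))"
        using Epos[of t] t mult_le_cancel_right_pos by fastforce
      then have "exp (l t) * (2 * t * l' t) \<le> exp (l t) * (- (c / (1 + \<alpha>\<^sup>2)))"
        by (intro mult_left_mono) auto
      then show "x * (exp (l (x\<^sup>2)) * (2 * l' (x\<^sup>2)) * x) \<le> - (c / (1 + \<alpha>\<^sup>2)) * exp (l (x\<^sup>2))"
        unfolding t_def by (simp add: power2_eq_square mult_ac)
    qed (use c(1) in \<open>auto simp: add_pos_nonneg\<close>)
  qed
  have lim_U: "((\<lambda>x. x * u (x\<^sup>2)) \<longlongrightarrow> 0) at_top"
  proof -
    \<comment> \<open>With \<open>V = - U\<close> one obtains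
      \<open>x V' \<le> - c0 V + C / x\<close>. Adding \<open>2 C / x\<close> to \<open>V\<close>
      turns the forcing \<open>C / x\<close> into \<open>- C / x\<close>, which is half of
      \<open>- 2 C / x\<close>; this is why \<open>c\<close> is capped at 1/2.\<close>
    define c0 where "c0 = (r - 1) * (1 + u0) / (1 + \<alpha>\<^sup>2)"
    define c where "c = min c0 (1 / 2)"
    define C where "C = \<alpha>\<^sup>2 * (1 + real d) / (1 + u0)\<^sup>2"
    have A: "1 + \<alpha>\<^sup>2 > 0" by (simp add: add_pos_nonneg)
    have c0: "c0 > 0" using r u0 A by (simp add: c0_def)
    have c: "c > 0" "c \<le> c0" "c \<le> 1 / 2" using c0 by (auto simp: c_def)
    have C: "C \<ge> 0" by (simp add: C_def)
    define h where "h x = - (x * u (x\<^sup>2)) + 2 * C / x" for x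
    define h' where "h' x = - (u (x\<^sup>2) + 2 * x\<^sup>2 * u' (x\<^sup>2)) - 2 * C / x\<^sup>2" for x
    have "(h \<longlongrightarrow> 0) at_top"
    proof (rule tendsto_zero_of_euler_inequality[of _ h', OF _ _ _ c(1)])
      fix x :: real assume x: "x \<ge> 1"
      have "((\<lambda>x. 2 * C / x) has_real_derivative - 2 * C / x\<^sup>2) (at x)"
        using x by (auto intro!: derivative_eq_intros simp: power2_eq_square)
      from DERIV_add[OF DERIV_minus[OF DU] this]
      show "(h has_real_derivative h' x) (at x)"
        by (simp add: h_def[abs_def] h'_def)
      define t where "t = x\<^sup>2"
      have t: "t \<ge> 1" using x by (simp add: t_def)
      then have t0: "t \<ge> 0" by simp
      define V where "V = - (x * u t)"
      define e where "e = E t (u t) (l t)"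
      define B where "B = u t + real d * (u0 - u t)"
      have V: "V \<ge> 0" using bounds(2)[OF t0] x by (simp add: V_def mult_nonneg_nonpos)
      have e: "e > 0" using Epos[OF t0] by (simp add: e_def)
      have "2 * C / x \<ge> 0" using C x by simp
      then show "h x \<ge> 0" using V unfolding h_def V_def t_def by linarith
      \<comment> \<open>The first factor is \<open>U'\<close>. The products without
        \<open>\<alpha>\<^sup>2\<close> combine through \<open>(1 + u) - (r + u) = 1 - r\<close>,
        which gives the damping term.\<close>
      have "(u t + 2 * t * u' t) * e = t * (1 + u t) * u t * (1 - r) + \<alpha>\<^sup>2 * exp (2 * l t) * B"
        using u'[OF t0] unfolding e_def distrib_right
        by (simp only: u'[OF t0]) (simp add: E_def B_def power2_eq_square algebra_simps)
      then have W: "u t + 2 * t * u' t = (t * (1 + u t) * u t * (1 - r) + \<alpha>\<^sup>2 * exp (2 * l t) * B) / e"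
        using e by (simp add: eq_divide_eq)
      have 1: "x * (- (u t + 2 * t * u' t)) =
          - ((r - 1) * (1 + u t) * (t / e) * V) + x * (\<alpha>\<^sup>2 * exp (2 * l t) * (- B)) / e"
        unfolding W using e by (simp add: V_def field_simps)
      have "1 / (1 + \<alpha>\<^sup>2) \<le> t / e"
        using E_le[OF t] A e by (simp add: e_def field_simps)
      then have "(r - 1) * (1 + u0) * (1 / (1 + \<alpha>\<^sup>2)) \<le> (r - 1) * (1 + u t) * (t / e)"
        using r u0 bounds(1)[OF t0] A by (intro mult_mono) auto
      then have 2: "c0 * V \<le> (r - 1) * (1 + u t) * (t / e) * V"
        using V by (intro mult_right_mono) (auto simp: c0_def)
      have "- B \<le> 1 + real d"
      proof -
        have "real d * (u t - u0) \<le> real d * 1"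
          using bounds(2)[OF t0] u0 d by (intro mult_left_mono) auto
        then show ?thesis
          using bounds(1)[OF t0] u0 by (simp add: B_def algebra_simps)
      qed
      then have "\<alpha>\<^sup>2 * exp (2 * l t) * (- B) \<le> \<alpha>\<^sup>2 * exp (2 * l t) * (1 + real d)"
        by (intro mult_left_mono) auto
      also have "\<dots> \<le> \<alpha>\<^sup>2 * 1 * (1 + real d)"
        using bounds(3)[OF t0] by (intro mult_right_mono mult_left_mono) auto
      finally have "x * (\<alpha>\<^sup>2 * exp (2 * l t) * (- B)) / e \<le> x * (\<alpha>\<^sup>2 * 1 * (1 + real d)) / e"
        using x e by (intro divide_right_mono mult_left_mono) auto
      also have "\<dots> \<le> x * (\<alpha>\<^sup>2 * 1 * (1 + real d)) / ((1 + u0)\<^sup>2 * t)"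
        using x e u0 t E_ge[OF t0] by (intro divide_left_mono mult_pos_pos) (auto simp: e_def)
      also have "\<dots> = C / x"
        using x u0 by (simp add: C_def t_def power2_eq_square)
      finally have 3: "x * (- (u t + 2 * t * u' t)) \<le> - (c0 * V) + C / x"
        unfolding 1 using 2 by linarith
      have "x * h' x = x * (- (u t + 2 * t * u' t)) - 2 * C / x"
        using x by (simp add: h'_def t_def power2_eq_square right_diff_distrib)
      also have "\<dots> \<le> - (c0 * V) - C / x"
        using 3 by simp
      also have "\<dots> \<le> - (c * V) - c * (2 * C / x)"
      proof -
        have "c * V \<le> c0 * V" using c V by (intro mult_right_mono) auto
        moreover have "c * (2 * C / x) \<le> 1 / 2 * (2 * C / x)"
          using c C x by (intro mult_right_mono) auto
        ultimately show ?thesis by simp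
      qed
      also have "\<dots> = - c * h x"
        by (simp add: h_def V_def t_def algebra_simps)
      finally show "x * h' x \<le> - c * h x" .
    qed
    then have h_lim: "((\<lambda>x. - h x) \<longlongrightarrow> 0) at_top"
      using tendsto_minus[of h 0 at_top] by simp
    have "\<forall>\<^sub>F x in at_top. - h x \<le> x * u (x\<^sup>2)"
      by (rule eventually_mono[OF eventually_ge_at_top[of 1]]) (use C in \<open>simp add: h_def\<close>)
    moreover have "\<forall>\<^sub>F x in at_top. x * u (x\<^sup>2) \<le> 0"
      by (rule eventually_mono[OF eventually_ge_at_top[of 0]]) (simp add: bounds mult_nonneg_nonpos)
    ultimately show ?thesis
      using h_lim tendsto_const by (rule real_tendsto_sandwich)
  qed
  have eqs: "- (r - 1) * u t - (1 + u t) * (u t + 2 * t * u' t) + \<alpha> * exp (2 * l t) * (2 * l' t) = 0 \<and>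
        - (r - 1) - (1 + u t) * t * (2 * l' t) - \<alpha> * (u t + 2 * t * u' t) - \<alpha> * (real d - 1) * u t = 0"
    if "t \<ge> 0" for t
  proof -
    \<comment> \<open>After multiplication by \<open>e\<close> both equations become polynomial
      identities. The first holds for any \<open>u0\<close>; the second uses the value of
      \<open>u0\<close> through \<open>k\<close>.\<close>
    define x q w e b D where "x = u t" and "q = 2 * t * u' t" and "w = 2 * l' t"
      and "e = E t (u t) (l t)" and "b = exp (2 * l t)" and "D = real d"
    have e0: "e \<noteq> 0" using Epos[OF that] by (simp add: e_def)
    have qe: "q * e = \<alpha>\<^sup>2 * b * (D * (u0 - x)) - t * (1 + x) * x * (r + x)"
      using u'[OF that] by (simp add: q_def e_def x_def b_def D_def)
    have we: "w * e = (1 + x) * (\<alpha> * D * (u0 - x)) + \<alpha> * x * (r + x)"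
      using l'[OF that] by (simp add: w_def e_def x_def N_def D_def)
    have e: "e = t * (1 + x)\<^sup>2 + \<alpha>\<^sup>2 * b" by (simp add: e_def E_def x_def b_def)
    have k: "\<alpha> * D * u0 = 1 - r" using u0(3) by (simp add: D_def)
    have "(- (r - 1) * x - (1 + x) * (x + q) + \<alpha> * b * w) * e = 0"
      using qe we e by algebra
    moreover have "(- (r - 1) - (1 + x) * t * w - \<alpha> * (x + q) - \<alpha> * (D - 1) * x) * e = 0"
      using qe we e k by algebra
    ultimately show ?thesis
      using e0 by (simp add: x_def q_def w_def b_def D_def)
  qed
  show ?thesis
    by (rule exI[of _ \<delta>], rule conjI[OF \<delta>],
        rule exI[of _ u], rule exI[of _ l], rule exI[of _ u'], rule exI[of _ l'])
      (intro conjI allI impI smooth init lim_U lim_S DU DS conjunct1[OF eqs] conjunct2[OF eqs])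
qed

end

section \<open>Return to the original variables\<close>

theorem theorem1p1:
  fixes p d :: nat and r \<alpha> :: real
  assumes "odd p"
    and "\<alpha> = (real p - 1) / 4"
    and "d = CARD('n::finite)"
    and "r > 1"
    and "\<alpha> * real d > r - 1"
  shows "\<exists>U S :: real \<Rightarrow> real.
    smooth_profile_solution \<alpha> r d U S \<and>
    (U \<longlongrightarrow> 0) at_top \<and> (S \<longlongrightarrow> 0) at_top \<and>
    (\<exists>Uext Sext :: real \<Rightarrow> real.
       smooth_odd_extension U Uext \<and>
       smooth_even_extension S Sext \<and>
       smooth_on UNIV (radial_vector_field Uext :: real ^ 'n \<Rightarrow> real ^ 'n) \<and>
       smooth_on UNIV (radial_scalar_field Sext :: real ^ 'n \<Rightarrow> real) \<and>
       Sext 0 = 1 \<and>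
       (Uext has_real_derivative - (r - 1) / (\<alpha> * real d)) (at 0))"
proof -
  have "\<alpha> * real d > 0" using assms(4,5) by linarith
  then have "\<alpha> > 0" by (simp add: zero_less_mult_iff)
  then interpret elliptic_profile d r \<alpha>
    using assms(4,5) by unfold_locales
  obtain \<delta> u l u' l' where \<delta>: "\<delta> > 0" and smooth: "smooth_on {- \<delta><..} u" "smooth_on {- \<delta><..} l"
    and init: "u 0 = u0" "l 0 = 0"
    and lim: "((\<lambda>x. x * u (x\<^sup>2)) \<longlongrightarrow> 0) at_top" "((\<lambda>x. exp (l (x\<^sup>2))) \<longlongrightarrow> 0) at_top"
    and D: "\<forall>x. ((\<lambda>x. x * u (x\<^sup>2)) has_real_derivative u (x\<^sup>2) + 2 * x\<^sup>2 * u' (x\<^sup>2)) (at x) \<and>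
          ((\<lambda>x. exp (l (x\<^sup>2))) has_real_derivative exp (l (x\<^sup>2)) * (2 * l' (x\<^sup>2)) * x) (at x)"
    and eqs: "\<forall>t \<ge> 0. - (r - 1) * u t - (1 + u t) * (u t + 2 * t * u' t) + \<alpha> * exp (2 * l t) * (2 * l' t) = 0 \<and>
        - (r - 1) - (1 + u t) * t * (2 * l' t) - \<alpha> * (u t + 2 * t * u' t) - \<alpha> * (real d - 1) * u t = 0"
    using ex_profile by (elim exE conjE) (rule that; assumption)
  define U where "U x = x * u (x\<^sup>2)" for x
  define S where "S x = exp (l (x\<^sup>2))" for x
  have U_smooth: "smooth_on UNIV U"
    unfolding U_def[abs_def]
    using smooth_on_mult[OF open_UNIV smooth_on_linear[OF open_UNIV bounded_linear_ident]
        smooth_on_norm_square[where 'a = real, OF smooth(1) \<delta>]] by simp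
  have S_smooth: "smooth_on UNIV S"
    unfolding S_def[abs_def]
    using smooth_on_exp[OF open_UNIV smooth_on_norm_square[where 'a = real, OF smooth(2) \<delta>]] by simp
  have vector_smooth: "smooth_on UNIV (radial_vector_field U :: real ^ 'n \<Rightarrow> real ^ 'n)"
  proof -
    \<comment> \<open>Away from the origin the factor \<open>norm y\<close> in \<open>U\<close>
      cancels the normalisation of \<open>y\<close>; at the origin both sides are 0 by the
      convention for division by zero.\<close>
    have "radial_vector_field U = (\<lambda>y :: real ^ 'n. u ((norm y)\<^sup>2) *\<^sub>R y)"
    proof
      show "radial_vector_field U y = u ((norm y)\<^sup>2) *\<^sub>R y" for y :: "real ^ 'n"
        by (cases "y = 0") (simp_all add: radial_vector_field_def U_def)
    qed
    then show ?thesis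
      using smooth_on_scaleR[OF open_UNIV smooth_on_norm_square[where 'a = "real ^ 'n", OF smooth(1) \<delta>]
          smooth_on_linear[OF open_UNIV bounded_linear_ident]] by simp
  qed
  have scalar_smooth: "smooth_on UNIV (radial_scalar_field S :: real ^ 'n \<Rightarrow> real)"
    unfolding radial_scalar_field_def[abs_def] S_def
    using smooth_on_exp[OF open_UNIV smooth_on_norm_square[where 'a = "real ^ 'n", OF smooth(2) \<delta>]] .
  have U'0: "(U has_real_derivative - (r - 1) / (\<alpha> * real d)) (at 0)"
    using D[THEN spec, THEN conjunct1, of 0] init unfolding U_def[abs_def] u0_def by simp
  have "0 = - (r - 1) * U x - x * deriv U x - U x * deriv U x + \<alpha> * S x * deriv S x \<and>
        0 = - (r - 1) * S x - x * deriv S x - U x * deriv S x - \<alpha> * S x * deriv U x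
            - \<alpha> * (real d - 1) * (S x * U x / x)" if "x > 0" for x
  proof -
    have dU: "deriv U x = u (x\<^sup>2) + 2 * x\<^sup>2 * u' (x\<^sup>2)"
      using D[THEN spec, THEN conjunct1, of x] unfolding U_def[abs_def] by (rule DERIV_imp_deriv)
    have dS: "deriv S x = S x * (2 * l' (x\<^sup>2)) * x"
      using D[THEN spec, THEN conjunct2, of x] unfolding S_def[abs_def] by (rule DERIV_imp_deriv)
    have S2: "exp (2 * l (x\<^sup>2)) = S x * S x"
      by (simp add: S_def flip: exp_add)
    note eq = eqs[THEN spec, THEN mp, OF zero_le_power2[of x], unfolded S2, folded dU]
    have "- (r - 1) * U x - x * deriv U x - U x * deriv U x + \<alpha> * S x * deriv S x
        = x * (- (r - 1) * u (x\<^sup>2) - (1 + u (x\<^sup>2)) * deriv U x + \<alpha> * (S x * S x) * (2 * l' (x\<^sup>2)))"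
      by (simp add: dS) (simp add: U_def algebra_simps)
    moreover have "- (r - 1) * S x - x * deriv S x - U x * deriv S x - \<alpha> * S x * deriv U x
            - \<alpha> * (real d - 1) * (S x * U x / x)
        = S x * (- (r - 1) - (1 + u (x\<^sup>2)) * x\<^sup>2 * (2 * l' (x\<^sup>2)) - \<alpha> * deriv U x
            - \<alpha> * (real d - 1) * u (x\<^sup>2))"
    proof -
      have "S x * U x / x = S x * u (x\<^sup>2)" using that by (simp add: U_def)
      then show ?thesis
        by (simp only: dS) (simp add: U_def power2_eq_square algebra_simps)
    qed
    ultimately show ?thesis
      using eq by simp
  qed
  then have "smooth_profile_solution \<alpha> r d U S"
    using smooth_on_subset[OF U_smooth subset_UNIV] smooth_on_subset[OF S_smooth subset_UNIV]
    by (simp add: smooth_profile_solution_def)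
  moreover have "(U \<longlongrightarrow> 0) at_top" "(S \<longlongrightarrow> 0) at_top"
    using lim by (simp_all add: U_def[abs_def] S_def[abs_def])
  \<comment> \<open>The formulas \<open>x * u (x\<^sup>2)\<close> and
    \<open>exp (l (x\<^sup>2))\<close> already have the required parity on the whole line, so each
    function is its own extension.\<close>
  moreover have "smooth_odd_extension U U" "smooth_even_extension S S"
    using U_smooth S_smooth by (simp_all add: smooth_odd_extension_def smooth_even_extension_def U_def S_def)
  moreover have "S 0 = 1"
    using init by (simp add: S_def)
  ultimately show ?thesis
    using vector_smooth scalar_smooth U'0 by blast
qed

end
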